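(* Let $K$ be a field and let $n,d$ be positive integers with $2\leq d<2n$. Let $I_{2,n,d}\subset S=K[x_1,\ldots,x_n]$ be the Veronese type ideal with constant bound $2$. Then $I_{2,n,d}$ is Freiman if and only if one of the following conditions holds: (a) $n=2$ and $d=2$ or $d=3$; (b) $n=3$ and $d=2$, or $d=4$, or $d=5$; (c) $n\geq 4$ and $d=2n-1$.
   Context: For positive integers $k,n,d$ with $k\leq d$ and $kn>d$, the Veronese type ideal with constant bound $k$ is the monomial ideal $I_{k,n,d}\subset S=K[x_1,\ldots,x_n]$ whose minimal monomial generators are the monomials $x_1^{b_1}\cdots x_n^{b_n}$ with $\sum_{i=1}^n b_i=d$ and $0\leq b_i\leq k$ for all $i$. For an equigenerated monomial ideal $I\subset S$ (all minimal generators of the same degree), let $\mu(I)$ denote its minimal number of generators and $\ell(I)$ its analytic spread, i.e. the Krull dimension of the fiber cone $F(I)=\bigoplus_{j\ge 0} I^j/\mathfrak{m}I^j$, where $\mathfrak{m}=(x_1,\ldots,x_n)$. The ideal $I$ is called Freiman if $\mu(I^2)=\ell(I)\mu(I)-\binom{\ell(I)}{2}$. *)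

theory Defs
  imports
    "HOL-Algebra.Algebra"
    "HOL-Algebra.UnivPoly"
    "HOL-Library.Poly_Mapping"
    "HOL-Library.Extended_Nat"
begin

text \<open>
  Exponent vectors are finitely supported maps from variable indices to naturals, and a
  polynomial is a finitely supported map from exponent vectors to coefficients. The ring
  K[x_1, ..., x_n] consists of those polynomials in which only x_1, ..., x_n occur; K is the
  coefficient type.
\<close>

definition mpoly_ring :: "nat \<Rightarrow> ((nat \<Rightarrow>\<^sub>0 nat) \<Rightarrow>\<^sub>0 'k::field) ring"
  where "mpoly_ring n =
    \<lparr> carrier = {p. \<forall>b \<in> Poly_Mapping.keys p. Poly_Mapping.keys b \<subseteq> {1..n}},
      monoid.mult = (*), one = 1, ring.zero = 0, add = (+) \<rparr>"

definition monomial :: "(nat \<Rightarrow>\<^sub>0 nat) \<Rightarrow> ((nat \<Rightarrow>\<^sub>0 nat) \<Rightarrow>\<^sub>0 'k::field)"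
  where "monomial b = Poly_Mapping.single b 1"

definition exponents :: "nat \<Rightarrow> nat \<Rightarrow> (nat \<Rightarrow>\<^sub>0 nat) set"
  where "exponents n d =
    {b. Poly_Mapping.keys b \<subseteq> {1..n} \<and> (\<Sum>i = 1..n. Poly_Mapping.lookup b i) = d}"

definition max_ideal :: "nat \<Rightarrow> ((nat \<Rightarrow>\<^sub>0 nat) \<Rightarrow>\<^sub>0 'k::field) set"
  where "max_ideal n =
    Idl\<^bsub>mpoly_ring n\<^esub> ((\<lambda>i. monomial (Poly_Mapping.single i 1)) ` {1..n})"

definition veronese_ideal :: "nat \<Rightarrow> nat \<Rightarrow> nat \<Rightarrow> ((nat \<Rightarrow>\<^sub>0 nat) \<Rightarrow>\<^sub>0 'k::field) set"
  where "veronese_ideal k n d =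
    Idl\<^bsub>mpoly_ring n\<^esub> (monomial ` {b \<in> exponents n d. \<forall>i \<in> {1..n}. Poly_Mapping.lookup b i \<le> k})"

text \<open>
  Monomials of the same degree do not properly divide each other, so a generating set
  consisting of monomials of one degree is automatically the set of minimal generators.
\<close>

definition equigenerated_monomial_ideal :: "nat \<Rightarrow> ((nat \<Rightarrow>\<^sub>0 nat) \<Rightarrow>\<^sub>0 'k::field) set \<Rightarrow> bool"
  where "equigenerated_monomial_ideal n I \<longleftrightarrow>
    (\<exists>e. \<exists>B \<subseteq> exponents n e. I = Idl\<^bsub>mpoly_ring n\<^esub> (monomial ` B))"

definition ideal_power :: "('a, 'b) ring_scheme \<Rightarrow> 'a set \<Rightarrow> nat \<Rightarrow> 'a set"
  where "ideal_power R I j = I [^]\<^bsub>ideals_set R\<^esub> j"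

definition min_num_gens :: "('a, 'b) ring_scheme \<Rightarrow> 'a set \<Rightarrow> nat"
  where "min_num_gens R I =
    (LEAST r. \<exists>G \<subseteq> carrier R. finite G \<and> card G = r \<and> Idl\<^bsub>R\<^esub> G = I)"

definition krull_dim :: "('a, 'b) ring_scheme \<Rightarrow> enat"
  where "krull_dim R =
    Sup {enat r | r. \<exists>P. (\<forall>i \<le> r. primeideal (P i) R) \<and> (\<forall>i < r. P i \<subset> P (Suc i))}"

text \<open>
  The direct sum of the powers I^j is realised inside the univariate polynomial ring over R as
  the subring of all polynomials whose j-th coefficient lies in I^j. The direct sum of
  the quotients I^j/MI^j, with the multiplication induced by that of R, is the quotient of
  this ring by the polynomials whose j-th coefficient lies in MI^j.
\<close>

definition rees_ring :: "('a, 'b) ring_scheme \<Rightarrow> 'a set \<Rightarrow> ('a, nat \<Rightarrow> 'a) up_ring"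
  where "rees_ring R I = (UP R)\<lparr>carrier := {f \<in> carrier (UP R). \<forall>j. f j \<in> ideal_power R I j}\<rparr>"

definition fiber_cone ::
    "('a, 'b) ring_scheme \<Rightarrow> 'a set \<Rightarrow> 'a set \<Rightarrow> (nat \<Rightarrow> 'a) set ring"
  where "fiber_cone R M I =
    rees_ring R I Quot {f \<in> carrier (UP R). \<forall>j. f j \<in> ideal_prod R M (ideal_power R I j)}"

definition analytic_spread :: "nat \<Rightarrow> ((nat \<Rightarrow>\<^sub>0 nat) \<Rightarrow>\<^sub>0 'k::field) set \<Rightarrow> enat"
  where "analytic_spread n I = krull_dim (fiber_cone (mpoly_ring n) (max_ideal n) I)"

definition freiman :: "nat \<Rightarrow> ((nat \<Rightarrow>\<^sub>0 nat) \<Rightarrow>\<^sub>0 'k::field) set \<Rightarrow> bool"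
  where "freiman n I \<longleftrightarrow>
    equigenerated_monomial_ideal n I \<and>
    (\<exists>l. analytic_spread n I = enat l \<and>
      int (min_num_gens (mpoly_ring n) (ideal_power (mpoly_ring n) I 2)) =
        int l * int (min_num_gens (mpoly_ring n) I) - int (l choose 2))"

end

theory Submission
  imports Defs
begin

text \<open>
Let \<open>I\<close> be the Veronese type ideal of degree \<open>d\<close> with bound 2, and let \<open>B\<close> be the set of exponent
vectors of its generators: the lattice points of the cube $[0,2]^n$ with coordinate sum \<open>d\<close>.
The proof turns the three invariants in the Freiman equality into combinatorics of \<open>B\<close>.

Numbers of generators. Modulo higher degrees, a generating set of a monomial ideal generated in
one degree must span the linearly independent monomials of that degree, so the minimal number of
generators is the number of these monomials (\<open>min_num_gens_monomials\<close>). Every lattice point of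
$[0,4]^n$ with sum \<open>2d\<close> is a sum of two elements of \<open>B\<close> (\<open>sumset_veronese_2\<close>). Hence the numbers of
generators of \<open>I\<close> and of its square both count lattice points of a cube on a hyperplane.

Analytic spread. Sending \<open>f\<close> to the sum of the parts of lowest possible degree of its coefficients
identifies the fiber cone with the ring spanned by the monomials whose exponents lie in the monoid
generated by \<open>B\<close> (\<open>analytic_spread_eq\<close>). Its dimension is at most \<open>n\<close>: elements picked from the
successive differences of a chain of primes satisfy no polynomial relation over the field
(\<open>prime_chain_no_relation\<close>), but any \<open>n+1\<close> polynomials in \<open>n\<close> variables do
(\<open>algebraically_dependent\<close>). It is at least \<open>n\<close>: a full flag of faces of the cone over \<open>B\<close> yields a
chain of primes spanned by monomials (\<open>krull_dim_ge_length_face_chain\<close>, \<open>exists_vertex_flag\<close>).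
So the analytic spread is \<open>n\<close>, in all cases.

Counting. It remains to decide when the number of points for bound 4 equals \<open>n\<close> times the number of
points for bound 2, minus \<open>n\<close> choose 2. For $n \leq 3$ this is a finite computation, and for
$d = 2n-1$ complementation reduces it to coordinate sums 1 and 2. For $n \geq 4$ and
$2 \leq d \leq 2n-2$ equality fails because there are too many points for bound 4. Sort them by the
number of odd coordinates. Without odd coordinates there are the doubles of the points of \<open>B\<close>.
With two odd coordinates there are the sums over the edges of the graph on \<open>B\<close> that joins points
differing by $e_i - e_j$. A point with \<open>z\<close> zeros, \<open>o\<close> ones and \<open>t\<close> twos has degree $(n-1)o + tz$ in
this graph. Only points with $o \leq 1$ can have degree below $2(n-1)$, and their total deficit is at
most $n(n-1)$ (\<open>sum_moves_ge\<close>), so these two classes alone reach the Freiman bound. A point with four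
odd coordinates makes the inequality strict (\<open>card_box_4_gt\<close>).
\<close>

abbreviation "keys \<equiv> Poly_Mapping.keys"
abbreviation "lookup \<equiv> Poly_Mapping.lookup"
abbreviation "single \<equiv> Poly_Mapping.single"

section \<open>Rings inside a commutative ring type\<close>

text \<open>
The polynomial ring and the rings spanned by monomials share the operations of one polynomial
type and differ only in their carriers.
\<close>

definition subring_of :: "'a::comm_ring_1 set \<Rightarrow> 'a ring"
  where "subring_of C = \<lparr>carrier = C, monoid.mult = (*), one = 1, ring.zero = 0, add = (+)\<rparr>"

lemma subring_of_simps [simp]:
  "carrier (subring_of C) = C" "a \<otimes>\<^bsub>subring_of C\<^esub> b = a * b" "\<one>\<^bsub>subring_of C\<^esub> = 1"
  "\<zero>\<^bsub>subring_of C\<^esub> = 0" "a \<oplus>\<^bsub>subring_of C\<^esub> b = a + b"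
  by (simp_all add: subring_of_def)

definition subring_closed :: "'a::comm_ring_1 set \<Rightarrow> bool"
  where "subring_closed C \<longleftrightarrow> 1 \<in> C \<and> (\<forall>a\<in>C. \<forall>b\<in>C. a - b \<in> C \<and> a * b \<in> C)"

lemma subring_closedD:
  assumes "subring_closed C"
  shows "1 \<in> C" "0 \<in> C" "a \<in> C \<Longrightarrow> - a \<in> C" "a \<in> C \<Longrightarrow> b \<in> C \<Longrightarrow> a - b \<in> C"
    "a \<in> C \<Longrightarrow> b \<in> C \<Longrightarrow> a + b \<in> C" "a \<in> C \<Longrightarrow> b \<in> C \<Longrightarrow> a * b \<in> C"
proof -
  have d: "a - b \<in> C" if "a \<in> C" "b \<in> C" for a b
    using assms that by (auto simp: subring_closed_def)
  show "1 \<in> C"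
    using assms by (auto simp: subring_closed_def)
  then show z: "0 \<in> C"
    using d[of 1 1] by simp
  show m: "- a \<in> C" if "a \<in> C" for a
    using d[OF z that] by simp
  show "a - b \<in> C" if "a \<in> C" "b \<in> C"
    using d that .
  show "a + b \<in> C" if "a \<in> C" "b \<in> C"
    using d[OF that(1) m[OF that(2)]] by simp
  show "a * b \<in> C" if "a \<in> C" "b \<in> C"
    using assms that by (auto simp: subring_closed_def)
qed

lemma cring_subring_of:
  assumes "subring_closed C"
  shows "cring (subring_of C)"
proof (rule cringI)
  note closed = subring_closedD[OF assms]
  show "abelian_group (subring_of C)"
  proof (rule abelian_groupI)
    show "\<exists>b\<in>carrier (subring_of C). b \<oplus>\<^bsub>subring_of C\<^esub> a = \<zero>\<^bsub>subring_of C\<^esub>"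
      if "a \<in> carrier (subring_of C)" for a
      using closed(3)[of a] that by (intro bexI[of _ "- a"]) auto
  qed (use closed in \<open>auto simp: algebra_simps\<close>)
  show "comm_monoid (subring_of C)"
    by (rule comm_monoidI) (use closed in \<open>auto simp: algebra_simps\<close>)
qed (auto simp: algebra_simps)

lemma finsum_subring_of:
  assumes "subring_closed C" and "\<And>i. i \<in> A \<Longrightarrow> f i \<in> C"
  shows "finsum (subring_of C) f A = sum f A \<and> sum f A \<in> C"
proof -
  interpret cring "subring_of C"
    by (rule cring_subring_of[OF assms(1)])
  show ?thesis
    using assms(2)
  proof (induction A rule: infinite_finite_induct)
    case (insert i A)
    then show ?case
      using subring_closedD(5)[OF assms(1)] by (simp add: Pi_def)
  qed (use subring_closedD(2)[OF assms(1)] in auto)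
qed

lemma a_inv_subring_of:
  assumes "subring_closed C" and "a \<in> C"
  shows "\<ominus>\<^bsub>subring_of C\<^esub> a = - a"
proof -
  interpret cring "subring_of C"
    by (rule cring_subring_of[OF assms(1)])
  show ?thesis
    using assms subring_closedD(3)[OF assms] by (intro minus_equality) auto
qed

text \<open>
Closure under negation is not listed because $-a = (-1) a$.
\<close>

lemma ideal_subring_of_iff:
  assumes C: "subring_closed C"
  shows "ideal J (subring_of C) \<longleftrightarrow>
    J \<subseteq> C \<and> 0 \<in> J \<and> (\<forall>a\<in>J. \<forall>b\<in>J. a + b \<in> J) \<and> (\<forall>c\<in>C. \<forall>a\<in>J. c * a \<in> J)" (is "_ \<longleftrightarrow> ?R")
proof
  assume "ideal J (subring_of C)"
  then interpret ideal J "subring_of C" .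
  show ?R
    using a_subset additive_subgroup.zero_closed[OF is_additive_subgroup]
      additive_subgroup.a_closed[OF is_additive_subgroup] I_l_closed by auto
next
  interpret cring "subring_of C"
    by (rule cring_subring_of[OF C])
  assume R: ?R
  have "subgroup J (add_monoid (subring_of C))"
  proof (rule group.subgroupI[OF a_group])
    show "inv\<^bsub>add_monoid (subring_of C)\<^esub> a \<in> J" if "a \<in> J" for a
    proof -
      have "- 1 * a \<in> J"
        using R that subring_closedD(3)[OF C subring_closedD(1)[OF C]] by blast
      then show ?thesis
        using a_inv_subring_of[OF C, of a] R that by (auto simp: a_inv_def)
    qed
  qed (use R in auto)
  moreover have "a * c \<in> J" if "a \<in> J" "c \<in> C" for a c
    using R that by (subst mult.commute) blast
  ultimately show "ideal J (subring_of C)"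
    using R by (intro idealI ring_axioms) auto
qed

lemma primeideal_subring_of_iff:
  assumes C: "subring_closed C"
  shows "primeideal P (subring_of C) \<longleftrightarrow>
    ideal P (subring_of C) \<and> 1 \<notin> P \<and> (\<forall>a\<in>C. \<forall>b\<in>C. a * b \<in> P \<longrightarrow> a \<in> P \<or> b \<in> P)" (is "_ \<longleftrightarrow> ?R")
proof
  assume "primeideal P (subring_of C)"
  then interpret primeideal P "subring_of C" .
  show ?R
    using is_ideal one_imp_carrier I_notcarr I_prime by auto
next
  assume R: ?R
  then show "primeideal P (subring_of C)"
    using subring_closedD(1)[OF C] by (intro primeidealI cring_subring_of[OF C]) auto
qed

section \<open>Polynomials supported on a set of exponents\<close>

definition supported :: "'m set \<Rightarrow> ('m \<Rightarrow>\<^sub>0 'k::zero) set"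
  where "supported A = {p. keys p \<subseteq> A}"

definition sumset :: "'m::plus set \<Rightarrow> 'm set \<Rightarrow> 'm set"
  where "sumset A B = {a + b | a b. a \<in> A \<and> b \<in> B}"

definition submonoid_set :: "'m::comm_monoid_add set \<Rightarrow> bool"
  where "submonoid_set A \<longleftrightarrow> 0 \<in> A \<and> (\<forall>a\<in>A. \<forall>b\<in>A. a + b \<in> A)"

text \<open>
The projection onto the span of the monomials with exponent in \<open>A\<close>.
\<close>

definition restrict_keys :: "'m set \<Rightarrow> ('m \<Rightarrow>\<^sub>0 'k::zero) \<Rightarrow> 'm \<Rightarrow>\<^sub>0 'k"
  where "restrict_keys A = Poly_Mapping.mapp (\<lambda>c x. if c \<in> A then x else 0)"

lemma lookup_restrict_keys: "lookup (restrict_keys A p) c = (if c \<in> A then lookup p c else 0)"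
  by (simp add: restrict_keys_def lookup_mapp when_def in_keys_iff)

lemma keys_restrict_keys: "keys (restrict_keys A p) = keys p \<inter> A"
  by (auto simp: in_keys_iff lookup_restrict_keys split: if_splits)

lemma restrict_keys_add:
  "restrict_keys A (p + q) = restrict_keys A p + restrict_keys A (q :: _ \<Rightarrow>\<^sub>0 'k::monoid_add)"
  by (rule poly_mapping_eqI) (simp add: lookup_restrict_keys lookup_add)

lemma restrict_keys_id: "keys p \<subseteq> A \<Longrightarrow> restrict_keys A p = p"
  by (rule poly_mapping_eqI) (auto simp: lookup_restrict_keys in_keys_iff)

lemma restrict_keys_eq_0: "keys p \<inter> A = {} \<longleftrightarrow> restrict_keys A p = 0"
  by (metis keys_restrict_keys keys_eq_empty)

lemma restrict_keys_0 [simp]: "restrict_keys A 0 = 0"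
  by (rule poly_mapping_eqI) (simp add: lookup_restrict_keys)

lemma restrict_keys_sum:
  "restrict_keys A (sum f I) = (\<Sum>i\<in>I. restrict_keys A (f i :: _ \<Rightarrow>\<^sub>0 'k::comm_monoid_add))"
  by (induction I rule: infinite_finite_induct) (simp_all add: restrict_keys_add)

lemma keys_mult_sumset: "keys (p * q) \<subseteq> sumset (keys p) (keys q)"
  using keys_mult[of p q] by (auto simp: sumset_def)

text \<open>
Split \<open>p\<close> and \<open>q\<close> into the parts inside and outside \<open>A\<close> and \<open>B\<close>: only the product of the two
inside parts meets \<open>C\<close>. This applies when \<open>A\<close>, \<open>B\<close> and \<open>C\<close> are one face of a monoid, and when they
select the lowest degrees of \<open>p\<close>, \<open>q\<close> and \<open>p * q\<close>.
\<close>

lemma restrict_keys_mult: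
  fixes p q :: "'m::comm_monoid_add \<Rightarrow>\<^sub>0 'k::comm_ring_1"
  assumes "\<And>a b. a \<in> keys p \<Longrightarrow> b \<in> keys q \<Longrightarrow> a + b \<in> C \<longleftrightarrow> a \<in> A \<and> b \<in> B"
  shows "restrict_keys C (p * q) = restrict_keys A p * restrict_keys B q"
proof -
  let ?p1 = "restrict_keys A p" and ?p2 = "restrict_keys (- A) p"
  let ?q1 = "restrict_keys B q" and ?q2 = "restrict_keys (- B) q"
  have p: "p = ?p1 + ?p2" and q: "q = ?q1 + ?q2"
    by (rule poly_mapping_eqI, simp add: lookup_restrict_keys lookup_add)+
  have pq: "p * q = ?p1 * ?q1 + (?p1 * ?q2 + ?p2 * q)"
    by (subst p, subst q, subst (3) q) (simp add: algebra_simps)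
  have in_C: "keys (?p1 * ?q1) \<subseteq> C"
    using keys_mult_sumset[of ?p1 ?q1] assms by (auto simp: sumset_def keys_restrict_keys)
  have "keys (?p1 * ?q2) \<inter> C = {}" "keys (?p2 * q) \<inter> C = {}"
    using keys_mult_sumset[of ?p1 ?q2] keys_mult_sumset[of ?p2 q] assms
    by (fastforce simp: sumset_def keys_restrict_keys)+
  then have "restrict_keys C (?p1 * ?q2) = 0" "restrict_keys C (?p2 * q) = 0"
    by (simp_all only: restrict_keys_eq_0)
  then show ?thesis
    by (subst pq) (simp add: restrict_keys_add restrict_keys_id[OF in_C])
qed

lemma sum_singles: "p = (\<Sum>c\<in>keys p. single c (lookup p c))"
  by (rule poly_mapping_eqI)
    (simp add: lookup_sum lookup_single when_def in_keys_iff sum.delta)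

lemma supported_subset_if_singles:
  fixes J :: "('m \<Rightarrow>\<^sub>0 'k::comm_monoid_add) set"
  assumes "0 \<in> J" and "\<And>p q. p \<in> J \<Longrightarrow> q \<in> J \<Longrightarrow> p + q \<in> J"
    and "\<And>c x. c \<in> E \<Longrightarrow> single c x \<in> J"
  shows "supported E \<subseteq> J"
proof
  fix p :: "'m \<Rightarrow>\<^sub>0 'k"
  assume p: "p \<in> supported E"
  have "(\<Sum>c\<in>K. single c (lookup p c)) \<in> J" if "K \<subseteq> E" for K
    using that by (induction K rule: infinite_finite_induct) (use assms in auto)
  then show "p \<in> J"
    using p by (subst sum_singles) (auto simp: supported_def)
qed

lemma single_in_supported: "c \<in> A \<Longrightarrow> single c x \<in> supported A"
  by (auto simp: supported_def)

lemma supported_mult: "p \<in> supported A \<Longrightarrow> q \<in> supported B \<Longrightarrow> p * q \<in> supported (sumset A B)"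
  using keys_mult_sumset[of p q] by (fastforce simp: supported_def sumset_def)

lemma supported_add: "p \<in> supported A \<Longrightarrow> q \<in> supported A \<Longrightarrow> p + q \<in> supported A"
  using keys_add[of p q] by (auto simp: supported_def)

lemma supported_mono: "A \<subseteq> B \<Longrightarrow> supported A \<subseteq> supported B"
  by (auto simp: supported_def)

lemma zero_in_supported: "0 \<in> supported A"
  by (simp add: supported_def)

lemma sumset_submonoid: "submonoid_set A \<Longrightarrow> sumset A A \<subseteq> A"
  by (auto simp: submonoid_set_def sumset_def)

lemma subring_closed_supported:
  assumes "submonoid_set A"
  shows "subring_closed (supported A :: ('m::comm_monoid_add \<Rightarrow>\<^sub>0 'k::comm_ring_1) set)"
proof -
  have "p - q \<in> supported A" if "p \<in> supported A" "q \<in> supported A" for p q :: "'m \<Rightarrow>\<^sub>0 'k"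
    using keys_diff[of p q] that by (auto simp: supported_def)
  moreover have "p * q \<in> supported A" if "p \<in> supported A" "q \<in> supported A" for p q :: "'m \<Rightarrow>\<^sub>0 'k"
    using supported_mult[OF that] supported_mono[OF sumset_submonoid[OF assms]] by blast
  ultimately show ?thesis
    using assms by (auto simp: subring_closed_def submonoid_set_def supported_def)
qed

lemma ideal_supported:
  assumes A: "submonoid_set A" and "E \<subseteq> A" and "sumset A E \<subseteq> E"
  shows "ideal (supported E) (subring_of (supported A :: ('m::comm_monoid_add \<Rightarrow>\<^sub>0 'k::comm_ring_1) set))"
proof -
  have "supported E \<subseteq> (supported A :: ('m \<Rightarrow>\<^sub>0 'k) set)"
    by (rule supported_mono[OF assms(2)])
  moreover have "p * q \<in> supported E" if "p \<in> supported A" "q \<in> supported E" for p q :: "'m \<Rightarrow>\<^sub>0 'k"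
    using supported_mult[OF that] supported_mono[OF assms(3)] by blast
  ultimately show ?thesis
    unfolding ideal_subring_of_iff[OF subring_closed_supported[OF A]]
    by (auto intro: supported_add zero_in_supported)
qed

lemma genideal_monomials:
  assumes A: "submonoid_set A" and B: "B \<subseteq> A"
  shows "Idl\<^bsub>subring_of (supported A)\<^esub> (monomial ` B) =
    (supported (sumset A B) :: ((nat \<Rightarrow>\<^sub>0 nat) \<Rightarrow>\<^sub>0 'k::field) set)"
proof
  let ?R = "subring_of (supported A :: ((nat \<Rightarrow>\<^sub>0 nat) \<Rightarrow>\<^sub>0 'k) set)"
  have "sumset A B \<subseteq> A"
    using A B by (auto simp: sumset_def submonoid_set_def)
  moreover have "sumset A (sumset A B) \<subseteq> sumset A B"
  proof
    fix c assume "c \<in> sumset A (sumset A B)"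
    then obtain a a' b where "c = a + (a' + b)" "a \<in> A" "a' \<in> A" "b \<in> B"
      by (auto simp: sumset_def)
    then have "c = (a + a') + b" "a + a' \<in> A"
      using A by (auto simp: submonoid_set_def add.assoc)
    then show "c \<in> sumset A B"
      using \<open>b \<in> B\<close> by (auto simp: sumset_def)
  qed
  ultimately have id: "ideal (supported (sumset A B)) ?R"
    by (rule ideal_supported[OF A])
  have "b \<in> sumset A B" if "b \<in> B" for b
  proof -
    have "0 + b \<in> sumset A B"
      using A that unfolding sumset_def submonoid_set_def by blast
    then show ?thesis
      by simp
  qed
  then have "monomial ` B \<subseteq> supported (sumset A B)"
    by (auto simp: monomial_def intro!: single_in_supported)
  then show "Idl\<^bsub>?R\<^esub> (monomial ` B) \<subseteq> supported (sumset A B)"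
    unfolding genideal_def using id by auto
  show "supported (sumset A B) \<subseteq> Idl\<^bsub>?R\<^esub> (monomial ` B)"
    unfolding genideal_def
  proof (rule Inter_greatest, clarify)
    fix J and p :: "(nat \<Rightarrow>\<^sub>0 nat) \<Rightarrow>\<^sub>0 'k"
    assume J: "ideal J ?R" "monomial ` B \<subseteq> J" and p: "p \<in> supported (sumset A B)"
    note J' = J(1)[unfolded ideal_subring_of_iff[OF subring_closed_supported[OF A]]]
    have "supported (sumset A B) \<subseteq> J"
    proof (rule supported_subset_if_singles)
      fix c x assume "c \<in> sumset A B"
      then obtain a b where ab: "c = a + b" "a \<in> A" "b \<in> B"
        by (auto simp: sumset_def)
      have "single a x * monomial b \<in> J"
        using J' J(2) ab single_in_supported[OF ab(2), of x] by blast
      then show "single c x \<in> J"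
        by (simp add: monomial_def mult_single ab)
    qed (use J' in auto)
    then show "p \<in> J"
      using p by auto
  qed
qed

lemma ideal_prod_supported:
  "ideal_prod (subring_of (supported A)) (supported E) (supported F)
    = (supported (sumset E F) :: ('m::comm_monoid_add \<Rightarrow>\<^sub>0 'k::comm_ring_1) set)"
proof
  let ?R = "subring_of (supported A :: ('m \<Rightarrow>\<^sub>0 'k) set)"
  show "ideal_prod ?R (supported E) (supported F) \<subseteq> supported (sumset E F)"
  proof
    fix p assume "p \<in> ideal_prod ?R (supported E) (supported F)"
    then show "p \<in> supported (sumset E F)"
      by induction (auto intro: supported_mult supported_add)
  qed
  show "supported (sumset E F) \<subseteq> ideal_prod ?R (supported E) (supported F)"
  proof (rule supported_subset_if_singles)
    show "0 \<in> ideal_prod ?R (supported E) (supported F)"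
      using ideal_prod.prod[where R = ?R, OF zero_in_supported zero_in_supported, of E F] by simp
    show "p + q \<in> ideal_prod ?R (supported E) (supported F)"
      if "p \<in> ideal_prod ?R (supported E) (supported F)" "q \<in> ideal_prod ?R (supported E) (supported F)" for p q
      using ideal_prod.sum[OF that] by simp
    fix c and x :: 'k assume "c \<in> sumset E F"
    then obtain a b where ab: "c = a + b" "a \<in> E" "b \<in> F"
      by (auto simp: sumset_def)
    have "single a x \<otimes>\<^bsub>?R\<^esub> single b 1 \<in> ideal_prod ?R (supported E) (supported F)"
      using ab by (intro ideal_prod.prod single_in_supported)
    then show "single c x \<in> ideal_prod ?R (supported E) (supported F)"
      by (simp add: mult_single ab)
  qed
qed

text \<open>
The \<open>j\<close>-fold sumset, usually written \<open>jB\<close>: the exponents of the products of \<open>j\<close> generators.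
\<close>

fun multisum :: "'m::comm_monoid_add set \<Rightarrow> nat \<Rightarrow> 'm set" where
  "multisum B 0 = {0}"
| "multisum B (Suc j) = sumset (multisum B j) B"

lemma sumset_assoc: "sumset (sumset A B) C = sumset A (sumset B (C :: 'm::semigroup_add set))"
proof (intro equalityI subsetI)
  fix x assume "x \<in> sumset (sumset A B) C"
  then obtain a b c where "x = (a + b) + c" "a \<in> A" "b \<in> B" "c \<in> C"
    by (auto simp: sumset_def)
  then have "x = a + (b + c)" "b + c \<in> sumset B C"
    by (auto simp: sumset_def add.assoc)
  then show "x \<in> sumset A (sumset B C)"
    using \<open>a \<in> A\<close> by (auto simp: sumset_def)
next
  fix x assume "x \<in> sumset A (sumset B C)"
  then obtain a b c where "x = a + (b + c)" "a \<in> A" "b \<in> B" "c \<in> C"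
    by (auto simp: sumset_def)
  then have "x = (a + b) + c" "a + b \<in> sumset A B"
    by (auto simp: sumset_def add.assoc)
  then show "x \<in> sumset (sumset A B) C"
    using \<open>c \<in> C\<close> by (auto simp: sumset_def)
qed

lemma sumset_commute: "sumset A B = sumset B (A :: 'm::ab_semigroup_add set)"
  by (auto simp: sumset_def) (metis add.commute)+

lemma sumset_0 [simp]: "sumset A {0} = (A :: 'm::comm_monoid_add set)" "sumset {0} A = A"
  by (auto simp: sumset_def)

lemma sumset_self: "submonoid_set A \<Longrightarrow> sumset A A = A"
proof (intro equalityI sumset_submonoid subsetI)
  fix a assume "submonoid_set A" "a \<in> A"
  then have "0 + a \<in> sumset A A"
    unfolding submonoid_set_def sumset_def by blast
  then show "a \<in> sumset A A"
    by simp
qed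

lemma multisum_subset: "submonoid_set A \<Longrightarrow> B \<subseteq> A \<Longrightarrow> multisum B j \<subseteq> A"
  by (induction j) (auto simp: submonoid_set_def sumset_def)

lemma multisum_add: "multisum B (i + j) = sumset (multisum B i) (multisum B j)"
  by (induction j) (simp_all add: sumset_assoc)

lemma ideal_power_monomials:
  assumes A: "submonoid_set A" and B: "B \<subseteq> A"
  shows "ideal_power (subring_of (supported A)) (Idl\<^bsub>subring_of (supported A)\<^esub> (monomial ` B)) j
    = supported (sumset A (multisum B j))"
proof (induction j)
  case 0
  then show ?case
    by (simp add: ideal_power_def ideals_set_def)
next
  case (Suc j)
  have "sumset (sumset A (multisum B j)) (sumset A B) = sumset A (sumset A (sumset (multisum B j) B))"
    by (metis sumset_assoc sumset_commute)
  then have eq: "sumset (sumset A (multisum B j)) (sumset A B) = sumset A (multisum B (Suc j))"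
    by (simp add: sumset_self[OF A] flip: sumset_assoc[of A A])
  have step: "ideal_power R I (Suc j) = ideal_prod R (ideal_power R I j) I" for R :: "(_, unit) ring_scheme" and I
    by (simp add: ideal_power_def ideals_set_def)
  show ?case
    by (simp only: step Suc) (simp only: genideal_monomials[OF assms] ideal_prod_supported eq)
qed

section \<open>The polynomial ring\<close>

definition expo :: "nat \<Rightarrow> (nat \<Rightarrow>\<^sub>0 nat) set"
  where "expo n = {c. keys c \<subseteq> {1..n}}"

definition tdeg :: "nat \<Rightarrow> (nat \<Rightarrow>\<^sub>0 nat) \<Rightarrow> nat"
  where "tdeg n c = (\<Sum>i = 1..n. lookup c i)"

lemma submonoid_expo: "submonoid_set (expo n)"
  using keys_add by (fastforce simp: submonoid_set_def expo_def)

lemma mpoly_ring_eq: "mpoly_ring n = subring_of (supported (expo n))"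
  by (auto simp: mpoly_ring_def subring_of_def supported_def expo_def)

lemma exponents_eq: "exponents n d = {c \<in> expo n. tdeg n c = d}"
  by (auto simp: exponents_def expo_def tdeg_def)

lemma exponents_subset_expo: "exponents n d \<subseteq> expo n"
  by (auto simp: exponents_eq)

lemma tdeg_add: "tdeg n (a + b) = tdeg n a + tdeg n b"
  by (simp add: tdeg_def lookup_add sum.distrib)

lemma tdeg_0 [simp]: "tdeg n 0 = 0"
  by (simp add: tdeg_def)

lemma lookup_outside: "c \<in> expo n \<Longrightarrow> i \<notin> {1..n} \<Longrightarrow> lookup c i = 0"
  unfolding expo_def mem_Collect_eq by (meson in_keys_iff subsetD)

lemma tdeg_eq_0:
  assumes "c \<in> expo n"
  shows "tdeg n c = 0 \<longleftrightarrow> c = 0"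
proof
  assume "tdeg n c = 0"
  then have "\<forall>i\<in>{1..n}. lookup c i = 0"
    unfolding tdeg_def by (subst (asm) sum_eq_0_iff) simp_all
  then show "c = 0"
    using lookup_outside[OF assms] by (intro poly_mapping_eqI) (metis lookup_zero)
qed simp

lemma finite_bounded_expo: "finite {c \<in> expo n. \<forall>i. lookup c i \<le> m}"
proof -
  have "inj_on lookup {c \<in> expo n. \<forall>i. lookup c i \<le> m}"
    by (auto simp: inj_on_def)
  moreover have "lookup ` {c \<in> expo n. \<forall>i. lookup c i \<le> m} \<subseteq>
      {f. \<forall>i. (i \<in> {1..n} \<longrightarrow> f i \<in> {..m}) \<and> (i \<notin> {1..n} \<longrightarrow> f i = 0)}"
    by (auto simp: expo_def in_keys_iff subset_iff)
  ultimately show ?thesis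
    by (rule inj_on_finite) (rule finite_set_of_finite_funs; simp)
qed

lemma finite_exponents: "finite (exponents n d)"
proof (rule finite_subset[OF _ finite_bounded_expo])
  show "exponents n d \<subseteq> {c \<in> expo n. \<forall>i. lookup c i \<le> d}"
  proof (clarsimp simp: exponents_eq)
    fix c i assume c: "c \<in> expo n"
    show "lookup c i \<le> tdeg n c"
    proof (cases "i \<in> {1..n}")
      case True
      then show ?thesis
        unfolding tdeg_def by (intro member_le_sum) auto
    next
      case False
      then have "lookup c i = 0"
        using c by (intro lookup_outside)
      then show ?thesis by simp
    qed
  qed
qed

section \<open>Minimal numbers of generators\<close>

text \<open>
Gaussian elimination: solving the equation \<open>w\<close> for an unknown \<open>p\<close> with nonzero coefficient removes
one equation and one unknown. This single fact of linear algebra gives both the lower bound for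
numbers of generators and the algebraic dependence of many polynomials.
\<close>

lemma homogeneous_system_nonzero_solution:
  fixes a :: "'i \<Rightarrow> 'w \<Rightarrow> 'k::field"
  assumes "finite W" and "finite I" and "card W < card I"
  shows "\<exists>q. (\<exists>i\<in>I. q i \<noteq> 0) \<and> (\<forall>w\<in>W. (\<Sum>i\<in>I. q i * a i w) = 0)"
  using assms
proof (induction W arbitrary: I a rule: finite_induct)
  case empty
  then have "I \<noteq> {}" by auto
  then show ?case by (intro exI[of _ "\<lambda>_. 1"]) auto
next
  case (insert w W)
  show ?case
  proof (cases "\<forall>i\<in>I. a i w = 0")
    case True
    obtain q where "\<exists>i\<in>I. q i \<noteq> 0" "\<forall>v\<in>W. (\<Sum>i\<in>I. q i * a i v) = 0"
      using insert.IH[of I a] insert.prems insert.hyps by auto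
    then show ?thesis
      using True by (intro exI[of _ q]) auto
  next
    case False
    then obtain p where p: "p \<in> I" "a p w \<noteq> 0" by blast
    define I' where "I' = I - {p}"
    have I: "I = insert p I'" "p \<notin> I'" "finite I'"
      using p insert.prems by (auto simp: I'_def)
    define b where "b i v = a i v - a i w / a p w * a p v" for i v
    have "card W < card I'"
      using insert.prems insert.hyps I by simp
    then obtain q where q: "\<exists>i\<in>I'. q i \<noteq> 0" "\<forall>v\<in>W. (\<Sum>i\<in>I'. q i * b i v) = 0"
      using insert.IH[of I' b] I(3) by auto
    define s where "s = (\<Sum>i\<in>I'. q i * a i w) / a p w"
    have sum: "(\<Sum>i\<in>I. (q(p := - s)) i * a i v) = (\<Sum>i\<in>I'. q i * a i v) - s * a p v" for v
    proof -
      have "(\<Sum>i\<in>I'. (q(p := - s)) i * a i v) = (\<Sum>i\<in>I'. q i * a i v)"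
        using I(2) by (intro sum.cong) auto
      then show ?thesis
        using I(2,3) by (simp add: I(1))
    qed
    have "(\<Sum>i\<in>I'. q i * a i v) - s * a p v = (\<Sum>i\<in>I'. q i * b i v)" for v
    proof -
      have "s * a p v = (\<Sum>i\<in>I'. q i * a i w * (a p v / a p w))"
        unfolding sum_distrib_right[symmetric] by (simp add: s_def)
      moreover have "q i * b i v = q i * a i v - q i * a i w * (a p v / a p w)" for i
        by (simp add: b_def algebra_simps)
      ultimately show ?thesis
        by (simp add: sum_subtractf)
    qed
    then have "(\<Sum>i\<in>I. (q(p := - s)) i * a i v) = 0" if "v \<in> W" for v
      unfolding sum using q(2) that by auto
    moreover have "(\<Sum>i\<in>I. (q(p := - s)) i * a i w) = 0"
      unfolding sum using p(2) by (simp add: s_def)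
    moreover have "\<exists>i\<in>I. (q(p := - s)) i \<noteq> 0"
      using q(1) I by auto
    ultimately show ?thesis
      by (intro exI[of _ "q(p := - s)"]) blast
  qed
qed

lemma lookup_single_0_mult: "lookup (single 0 x * p) c = x * lookup p c"
  for x :: "'k::comm_ring_1" and p :: "'m::comm_monoid_add \<Rightarrow>\<^sub>0 'k"
proof -
  have "single 0 x * p = single 0 x * (\<Sum>d\<in>keys p. single d (lookup p d))"
    by (rule arg_cong[OF sum_singles])
  also have "\<dots> = (\<Sum>d\<in>keys p. single d (x * lookup p d))"
    unfolding sum_distrib_left by (intro sum.cong refl) (simp add: mult_single)
  finally show ?thesis
    by (simp add: lookup_sum lookup_single when_def in_keys_iff sum.delta)
qed

text \<open>
A monomial of degree \<open>e\<close> in \<open>r * g\<close> can only arise from the constant term of \<open>r\<close>, because \<open>g\<close> has no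
terms of degree below \<open>e\<close>.
\<close>

lemma lookup_mult_lowest:
  fixes g r :: "(nat \<Rightarrow>\<^sub>0 nat) \<Rightarrow>\<^sub>0 'k::comm_ring_1"
  assumes "\<And>c. c \<in> keys g \<Longrightarrow> e \<le> tdeg n c" and "r \<in> supported (expo n)" and "tdeg n b = e"
  shows "lookup (r * g) b = lookup r 0 * lookup g b"
proof -
  have "restrict_keys {c. tdeg n c = e} (r * g) = restrict_keys {0} r * restrict_keys {c. tdeg n c = e} g"
  proof (rule restrict_keys_mult)
    fix a c assume "a \<in> keys r" "c \<in> keys g"
    then show "a + c \<in> {c. tdeg n c = e} \<longleftrightarrow> a \<in> {0} \<and> c \<in> {c. tdeg n c = e}"
      using assms(1)[of c] assms(2) tdeg_eq_0[of a n] by (auto simp: tdeg_add supported_def)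
  qed
  moreover have "restrict_keys {0} r = single 0 (lookup r 0)"
    by (rule poly_mapping_eqI) (simp add: lookup_restrict_keys lookup_single when_def)
  ultimately have "lookup (restrict_keys {c. tdeg n c = e} (r * g)) b
      = lookup (single 0 (lookup r 0) * restrict_keys {c. tdeg n c = e} g) b"
    by simp
  then show ?thesis
    using assms(3) by (simp add: lookup_single_0_mult lookup_restrict_keys)
qed

lemma genideal_subset_combinations:
  assumes C: "subring_closed C" and G: "G \<subseteq> C" "finite G" and p: "p \<in> Idl\<^bsub>subring_of C\<^esub> G"
  shows "\<exists>r. (\<forall>g. r g \<in> C) \<and> p = (\<Sum>g\<in>G. r g * g)"
proof -
  note closed = subring_closedD[OF C]
  define J where "J = (\<lambda>r. \<Sum>g\<in>G. r g * g) ` {r. \<forall>g. r g \<in> C}"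
  have J_I: "x \<in> J" if "x = (\<Sum>g\<in>G. r g * g)" "\<And>g. r g \<in> C" for x r
    unfolding J_def using that by (intro image_eqI) auto
  have "ideal J (subring_of C)"
    unfolding ideal_subring_of_iff[OF C]
  proof (intro conjI ballI)
    show "J \<subseteq> C"
    proof
      fix x assume "x \<in> J"
      then obtain r where r: "\<And>g. r g \<in> C" and x: "x = (\<Sum>g\<in>G. r g * g)"
        unfolding J_def by blast
      show "x \<in> C"
        unfolding x by (rule conjunct2[OF finsum_subring_of[OF C]]) (use closed(6) r G(1) in blast)
    qed
    show "0 \<in> J"
      by (rule J_I[of _ "\<lambda>_. 0"]) (simp_all add: closed(2))
    show "x + y \<in> J" if xy: "x \<in> J" "y \<in> J" for x y
    proof -
      obtain r s where rs: "\<And>g. r g \<in> C" "\<And>g. s g \<in> C"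
        and x: "x = (\<Sum>g\<in>G. r g * g)" and y: "y = (\<Sum>g\<in>G. s g * g)"
        using xy unfolding J_def by blast
      show ?thesis
        by (rule J_I[of _ "\<lambda>g. r g + s g"]) (simp_all add: x y sum.distrib distrib_right closed(5) rs)
    qed
    show "c * x \<in> J" if c: "c \<in> C" and "x \<in> J" for c x
    proof -
      obtain r where r: "\<And>g. r g \<in> C" and x: "x = (\<Sum>g\<in>G. r g * g)"
        using \<open>x \<in> J\<close> unfolding J_def by blast
      show ?thesis
        by (rule J_I[of _ "\<lambda>g. c * r g"]) (simp_all add: x sum_distrib_left mult.assoc closed(6) r c)
    qed
  qed
  moreover have "G \<subseteq> J"
  proof
    fix g assume "g \<in> G"
    have "(\<Sum>h\<in>G. (if h = g then 1 else 0) * h) = (\<Sum>h\<in>G. if h = g then h else 0)"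
      by (intro sum.cong) auto
    then have "g = (\<Sum>h\<in>G. (if h = g then 1 else 0) * h)"
      using G(2) \<open>g \<in> G\<close> by simp
    then show "g \<in> J"
      by (rule J_I) (simp add: closed(1,2))
  qed
  ultimately have "p \<in> J"
    using p unfolding genideal_def by blast
  then show ?thesis
    unfolding J_def by blast
qed

lemma keys_monomial: "keys (monomial b :: (nat \<Rightarrow>\<^sub>0 nat) \<Rightarrow>\<^sub>0 'k::field) = {b}"
  by (simp add: monomial_def)

lemma inj_monomial: "inj (monomial :: (nat \<Rightarrow>\<^sub>0 nat) \<Rightarrow> (nat \<Rightarrow>\<^sub>0 nat) \<Rightarrow>\<^sub>0 'k::field)"
proof (rule injI)
  fix b c assume "(monomial b :: (nat \<Rightarrow>\<^sub>0 nat) \<Rightarrow>\<^sub>0 'k) = monomial c"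
  then have "keys (monomial b :: (nat \<Rightarrow>\<^sub>0 nat) \<Rightarrow>\<^sub>0 'k) = keys (monomial c :: (nat \<Rightarrow>\<^sub>0 nat) \<Rightarrow>\<^sub>0 'k)"
    by (rule arg_cong)
  then show "b = c"
    by (simp add: keys_monomial)
qed

text \<open>
In degree \<open>e\<close>, ideal membership becomes linear algebra: coefficients from the polynomial ring act
through their constant terms, so the monomials with exponent in \<open>B\<close> lie in the span of the
degree-\<open>e\<close> parts of any generating set \<open>G\<close>. As they are linearly independent, \<open>G\<close> cannot be smaller.
\<close>

theorem min_num_gens_monomials:
  assumes B: "B \<subseteq> exponents n e"
  shows "min_num_gens (mpoly_ring n) (Idl\<^bsub>mpoly_ring n\<^esub> (monomial ` B :: ((nat \<Rightarrow>\<^sub>0 nat) \<Rightarrow>\<^sub>0 'k::field) set)) = card B"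
proof -
  define A where "A = expo n"
  have A: "submonoid_set A" and BA: "B \<subseteq> A"
    using submonoid_expo subset_trans[OF B exponents_subset_expo] by (simp_all add: A_def)
  let ?C = "supported A :: ((nat \<Rightarrow>\<^sub>0 nat) \<Rightarrow>\<^sub>0 'k) set"
  have C: "subring_closed ?C"
    by (rule subring_closed_supported[OF A])
  have finB: "finite B"
    by (rule finite_subset[OF B finite_exponents])
  let ?R = "subring_of ?C"
  let ?I = "Idl\<^bsub>?R\<^esub> (monomial ` B)"
  have I: "?I = supported (sumset A B)"
    by (rule genideal_monomials[OF A BA])
  let ?P = "\<lambda>r. \<exists>G\<subseteq>carrier ?R. finite G \<and> card G = r \<and> Idl\<^bsub>?R\<^esub> G = ?I"
  have "monomial ` B \<subseteq> carrier ?R"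
    using BA by (auto simp: monomial_def intro!: single_in_supported)
  moreover have "card (monomial ` B :: ((nat \<Rightarrow>\<^sub>0 nat) \<Rightarrow>\<^sub>0 'k) set) = card B"
    by (rule card_image) (rule inj_on_subset[OF inj_monomial subset_UNIV])
  ultimately have "?P (card B)"
    using finB by (intro exI[of _ "monomial ` B"] conjI finite_imageI) simp_all
  moreover have "card B \<le> r" if P: "?P r" for r
  proof (rule ccontr)
    assume "\<not> card B \<le> r"
    obtain G where G: "G \<subseteq> ?C" "finite G" "card G = r" "Idl\<^bsub>?R\<^esub> G = ?I"
      using P unfolding subring_of_simps by blast
    then have less: "card G < card B"
      using \<open>\<not> card B \<le> r\<close> by simp
    have "G \<subseteq> Idl\<^bsub>?R\<^esub> G"
      unfolding genideal_def by blast
    then have GI: "G \<subseteq> ?I"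
      by (simp only: G(4))
    have low: "e \<le> tdeg n c" if "g \<in> G" "c \<in> keys g" for g c
    proof -
      have "c \<in> sumset A B"
        using GI that I by (auto simp: supported_def)
      then show ?thesis
        using B by (auto simp: sumset_def tdeg_add exponents_eq)
    qed
    have "\<forall>b\<in>B. \<exists>r. (\<forall>g. r g \<in> ?C) \<and> monomial b = (\<Sum>g\<in>G. r g * g)"
    proof
      fix b assume "b \<in> B"
      have "monomial b \<in> ?I"
        unfolding genideal_def using \<open>b \<in> B\<close> by blast
      then have "monomial b \<in> Idl\<^bsub>?R\<^esub> G"
        by (simp only: G(4))
      then show "\<exists>r. (\<forall>g. r g \<in> ?C) \<and> monomial b = (\<Sum>g\<in>G. r g * g)"
        by (rule genideal_subset_combinations[OF C G(1,2)])
    qed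
    from bchoice[OF this] obtain r
      where r': "\<forall>b\<in>B. (\<forall>g. r b g \<in> ?C) \<and> monomial b = (\<Sum>g\<in>G. r b g * g)" ..
    have r: "r b g \<in> ?C" "monomial b = (\<Sum>g\<in>G. r b g * g)" if "b \<in> B" for b g
      using r' that by blast+
    have eq: "lookup (monomial b) c = (\<Sum>g\<in>G. lookup (r b g) 0 * lookup g c)" if "b \<in> B" "c \<in> B" for b c
    proof -
      have "tdeg n c = e"
        using B that by (auto simp: exponents_eq)
      then have "lookup (r b g * g) c = lookup (r b g) 0 * lookup g c" if "g \<in> G" for g
        using low[OF that] r(1)[OF \<open>b \<in> B\<close>] by (intro lookup_mult_lowest) (auto simp: A_def)
      then show ?thesis
        using r(2)[OF that(1)] by (simp add: lookup_sum)
    qed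
    \<comment> \<open>a linear combination of the monomials in which the contributions of all \<open>g\<close> cancel\<close>
    obtain q where q: "\<exists>b\<in>B. q b \<noteq> 0" "\<forall>g\<in>G. (\<Sum>b\<in>B. q b * lookup (r b g) 0) = 0"
      using homogeneous_system_nonzero_solution[OF G(2) finB less, of "\<lambda>b g. lookup (r b g) 0"] by blast
    obtain c where c: "c \<in> B" "q c \<noteq> 0"
      using q(1) by blast
    have "(\<Sum>b\<in>B. q b * lookup (monomial b) c) = (\<Sum>b\<in>B. if b = c then q b else 0)"
      by (intro sum.cong) (auto simp: monomial_def lookup_single)
    then have "q c = (\<Sum>b\<in>B. q b * lookup (monomial b) c)"
      using finB c(1) by simp
    also have "\<dots> = (\<Sum>b\<in>B. \<Sum>g\<in>G. q b * lookup (r b g) 0 * lookup g c)"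
      by (intro sum.cong refl) (simp add: eq c(1) sum_distrib_left mult.assoc)
    also have "\<dots> = (\<Sum>g\<in>G. (\<Sum>b\<in>B. q b * lookup (r b g) 0) * lookup g c)"
      by (subst sum.swap) (simp add: sum_distrib_right)
    also have "\<dots> = 0"
      using q(2) by simp
    finally show False
      using c(2) by simp
  qed
  ultimately have "(LEAST r. ?P r) = card B"
    by (intro Least_equality)
  then show ?thesis
    unfolding min_num_gens_def mpoly_ring_eq A_def .
qed

section \<open>Krull dimension of rings spanned by monomials\<close>

text \<open>
The monomial $x_0^{e_0} x_1^{e_1} \cdots$. The exponents form a list so that an induction can split
off the first variable.
\<close>

fun power_product :: "(nat \<Rightarrow> 'a::comm_ring_1) \<Rightarrow> nat list \<Rightarrow> 'a" where
  "power_product x [] = 1"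
| "power_product x (a # e) = x 0 ^ a * power_product (\<lambda>i. x (Suc i)) e"

lemma subring_closed_power: "subring_closed C \<Longrightarrow> a \<in> C \<Longrightarrow> a ^ k \<in> C"
  by (induction k) (simp_all add: subring_closedD)

lemma power_product_closed:
  assumes "subring_closed C"
  shows "(\<And>i. i < length e \<Longrightarrow> x i \<in> C) \<Longrightarrow> power_product x e \<in> C"
proof (induction e arbitrary: x)
  case (Cons a e)
  have "x 0 \<in> C"
    using Cons.prems[of 0] by simp
  moreover have "power_product (\<lambda>i. x (Suc i)) e \<in> C"
    using Cons.prems by (intro Cons.IH) simp
  ultimately show ?case
    by (simp add: subring_closedD(6)[OF assms] subring_closed_power[OF assms])
qed (simp add: subring_closedD(1)[OF assms])

lemma power_notin_prime:
  assumes C: "subring_closed C" and P: "primeideal P (subring_of C)" and a: "a \<in> C" "a \<notin> P"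
  shows "a ^ k \<notin> P"
proof (induction k)
  case (Suc k)
  then show ?case
    using P a subring_closed_power[OF C a(1)] unfolding primeideal_subring_of_iff[OF C]
    by (metis power_Suc)
qed (use P in \<open>simp add: primeideal_subring_of_iff[OF C]\<close>)

text \<open>
This bounds Krull dimension by transcendence degree without integral extensions. Suppose that the
value of a nonzero polynomial lies in $P_0$. Divide by the largest power of $x_0$ that divides all
its terms; the quotient still lies in the prime $P_0 \subseteq P_1$ because $x_0 \notin P_0$. Modulo
$x_0 \in P_1$ only the terms without $x_0$ survive, and they form a nonzero polynomial in one variable
less whose value lies in $P_1$. At the end of the chain a nonzero scalar lies in a prime ideal, which
is absurd. The map \<open>\<kappa>\<close> is the embedding of the scalars.
\<close>

lemma prime_chain_no_relation:
  fixes C :: "'a::comm_ring_1 set" and \<kappa> :: "'k::field \<Rightarrow> 'a"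
  assumes C: "subring_closed C" and \<kappa>: "\<And>s. \<kappa> s \<in> C" "\<And>s t. \<kappa> (s * t) = \<kappa> s * \<kappa> t" "\<kappa> 1 = 1"
  shows "(\<And>i. i \<le> r \<Longrightarrow> primeideal (P i) (subring_of C)) \<Longrightarrow> (\<And>i. i < r \<Longrightarrow> P i \<subseteq> P (Suc i)) \<Longrightarrow>
    (\<And>i. i < r \<Longrightarrow> x i \<in> P (Suc i) - P i) \<Longrightarrow> finite E \<Longrightarrow> E \<noteq> {} \<Longrightarrow>
    (\<And>e. e \<in> E \<Longrightarrow> length e = r \<and> q e \<noteq> 0) \<Longrightarrow> (\<Sum>e\<in>E. \<kappa> (q e) * power_product x e) \<notin> P 0"
proof (induction r arbitrary: P x E q)
  case 0
  have P: "primeideal (P 0) (subring_of C)"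
    using 0(1)[of 0] by simp
  note P' = P[unfolded primeideal_subring_of_iff[OF C] ideal_subring_of_iff[OF C]]
  have E: "E = {[]}"
    using 0(5,6) by fastforce
  then have "q [] \<noteq> 0"
    using 0(6) by simp
  have "\<kappa> (q []) \<notin> P 0"
  proof
    assume "\<kappa> (q []) \<in> P 0"
    then have "\<kappa> (inverse (q [])) * \<kappa> (q []) \<in> P 0"
      using P' \<kappa>(1) by blast
    then show False
      using P' \<kappa>(3) \<open>q [] \<noteq> 0\<close> by (simp flip: \<kappa>(2))
  qed
  then show ?case
    by (simp add: E)
next
  case (Suc r)
  note closed = subring_closedD[OF C]
  have prime: "primeideal (P i) (subring_of C)" if "i \<le> Suc r" for i
    using Suc.prems(1) that .
  note P0 = prime[of 0, simplified, unfolded primeideal_subring_of_iff[OF C] ideal_subring_of_iff[OF C]]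
  note P1 = prime[of "Suc 0", simplified, unfolded primeideal_subring_of_iff[OF C] ideal_subring_of_iff[OF C]]
  have xC: "x i \<in> C" if "i < Suc r" for i
  proof -
    have "P (Suc i) \<subseteq> C"
      using prime[of "Suc i"] that unfolding primeideal_subring_of_iff[OF C] ideal_subring_of_iff[OF C] by simp
    then show ?thesis
      using Suc.prems(3)[OF that] by blast
  qed
  have x0: "x 0 \<in> P (Suc 0)" "x 0 \<notin> P 0" "x 0 \<in> C"
    using Suc.prems(3)[of 0] xC[of 0] by simp_all
  define y where "y = (\<lambda>i. x (Suc i))"
  define m where "m = Min (hd ` E)"
  define E0 where "E0 = {e \<in> E. hd e = m}"
  \<comment> \<open>the terms without \<open>x 0\<close> after division by \<open>x 0 ^ m\<close>, and the quotient of the others by \<open>x 0\<close>\<close>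
  define S0 where "S0 = (\<Sum>e\<in>E0. \<kappa> (q e) * power_product y (tl e))"
  define S1 where "S1 = (\<Sum>e\<in>E - E0. \<kappa> (q e) * (x 0 ^ (hd e - m - 1) * power_product y (tl e)))"
  have E0: "E0 \<subseteq> E" "finite E0" "E0 \<noteq> {}"
  proof -
    show "E0 \<subseteq> E"
      by (auto simp: E0_def)
    then show "finite E0"
      using Suc.prems(4) finite_subset by blast
    have "m \<in> hd ` E"
      unfolding m_def using Suc.prems(4,5) by (intro Min_in) auto
    then show "E0 \<noteq> {}"
      by (auto simp: E0_def)
  qed
  have ge: "m \<le> hd e" if "e \<in> E" for e
    unfolding m_def using Suc.prems(4) that by simp
  have e_eq: "power_product x e = x 0 ^ hd e * power_product y (tl e)" if "e \<in> E" for e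
    using Suc.prems(6)[OF that] by (cases e) (simp_all add: y_def)
  have pC: "power_product y (tl e) \<in> C" if "e \<in> E" for e
    by (rule power_product_closed[OF C]) (use xC Suc.prems(6)[OF that] in \<open>simp add: y_def\<close>)
  have "S0 \<in> C"
    unfolding S0_def using E0(1) pC
    by (intro conjunct2[OF finsum_subring_of[OF C]] closed(6) \<kappa>(1)) blast
  have "S1 \<in> C"
    unfolding S1_def using pC x0(3)
    by (intro conjunct2[OF finsum_subring_of[OF C]] closed(6) \<kappa>(1) subring_closed_power[OF C]) blast+
  have "(\<Sum>e\<in>E0. \<kappa> (q e) * power_product x e) = x 0 ^ m * S0"
    unfolding S0_def sum_distrib_left
  proof (rule sum.cong[OF refl])
    fix e assume "e \<in> E0"
    then show "\<kappa> (q e) * power_product x e = x 0 ^ m * (\<kappa> (q e) * power_product y (tl e))"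
      using e_eq[of e] by (simp add: E0_def)
  qed
  moreover have "(\<Sum>e\<in>E - E0. \<kappa> (q e) * power_product x e) = x 0 ^ m * (x 0 * S1)"
    unfolding S1_def sum_distrib_left
  proof (rule sum.cong[OF refl])
    fix e assume e: "e \<in> E - E0"
    then have "m < hd e"
      using ge[of e] by (auto simp: E0_def)
    then have "hd e = m + Suc (hd e - m - 1)"
      by simp
    then have "x 0 ^ hd e = x 0 ^ m * (x 0 * x 0 ^ (hd e - m - 1))"
      by (metis power_Suc power_add)
    then show "\<kappa> (q e) * power_product x e =
        x 0 ^ m * (x 0 * (\<kappa> (q e) * (x 0 ^ (hd e - m - 1) * power_product y (tl e))))"
      using e_eq[of e] e by (simp add: mult_ac)
  qed
  ultimately have split: "(\<Sum>e\<in>E. \<kappa> (q e) * power_product x e) = x 0 ^ m * (S0 + x 0 * S1)"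
    by (simp add: sum.subset_diff[OF E0(1) Suc.prems(4)] distrib_left)
  have "S0 \<notin> P (Suc 0)"
  proof -
    have inj: "inj_on tl E0"
    proof (rule inj_onI)
      fix e f assume "e \<in> E0" "f \<in> E0" "tl e = tl f"
      then show "e = f"
        using Suc.prems(6)[of e] Suc.prems(6)[of f] E0(1) by (cases e; cases f) (auto simp: E0_def)
    qed
    have cons: "m # tl e = e" if "e \<in> E0" for e
      using that Suc.prems(6)[of e] by (cases e) (auto simp: E0_def)
    have "(\<Sum>e\<in>tl ` E0. \<kappa> (q (m # e)) * power_product y e) \<notin> P (Suc 0)"
    proof (rule Suc.IH[of "\<lambda>i. P (Suc i)" y "tl ` E0" "\<lambda>e. q (m # e)"])
      show "length e = r \<and> q (m # e) \<noteq> 0" if e: "e \<in> tl ` E0" for e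
      proof -
        obtain f where f: "f \<in> E0" "e = tl f"
          using e by blast
        then have "length f = Suc r" "q f \<noteq> 0"
          using Suc.prems(6) E0(1) by blast+
        then show ?thesis
          using cons[OF f(1)] f(2) by simp
      qed
    qed (use Suc.prems(1,2,3) E0(2,3) in \<open>simp_all add: y_def\<close>)
    moreover have "(\<Sum>e\<in>tl ` E0. \<kappa> (q (m # e)) * power_product y e) = S0"
      unfolding S0_def by (simp add: sum.reindex[OF inj] cons)
    ultimately show ?thesis
      by simp
  qed
  show ?case
  proof
    assume "(\<Sum>e\<in>E. \<kappa> (q e) * power_product x e) \<in> P 0"
    then have mem: "x 0 ^ m * (S0 + x 0 * S1) \<in> P 0"
      by (simp only: split)
    have "S0 + x 0 * S1 \<in> C"
      using \<open>S0 \<in> C\<close> \<open>S1 \<in> C\<close> x0(3) closed(5,6) by blast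
    moreover have "x 0 ^ m \<notin> P 0"
      using prime[of 0] x0(2,3) by (intro power_notin_prime[OF C]) auto
    ultimately have "S0 + x 0 * S1 \<in> P 0"
      using P0 mem subring_closed_power[OF C x0(3)] by blast
    then have "S0 + x 0 * S1 \<in> P (Suc 0)"
      using Suc.prems(2)[of 0] by blast
    moreover have "- S1 * x 0 \<in> P (Suc 0)"
      using P1 closed(3)[OF \<open>S1 \<in> C\<close>] x0(1) by blast
    ultimately have "(S0 + x 0 * S1) + (- S1 * x 0) \<in> P (Suc 0)"
      using P1 by blast
    then show False
      using \<open>S0 \<notin> P (Suc 0)\<close> by (simp add: algebra_simps)
  qed
qed

definition expo_cube :: "nat \<Rightarrow> nat \<Rightarrow> (nat \<Rightarrow>\<^sub>0 nat) set"
  where "expo_cube n m = {c \<in> expo n. \<forall>i. lookup c i \<le> m}"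

lemma finite_expo_cube: "finite (expo_cube n m)"
  unfolding expo_cube_def by (rule finite_bounded_expo)

lemma card_expo_cube: "card (expo_cube n m) \<le> (m + 1) ^ n"
proof -
  let ?f = "\<lambda>c. restrict (lookup c) {1..n}"
  have "inj_on ?f (expo_cube n m)"
  proof (rule inj_onI)
    fix c c' assume c: "c \<in> expo_cube n m" "c' \<in> expo_cube n m" and eq: "?f c = ?f c'"
    show "c = c'"
    proof (rule poly_mapping_eqI)
      fix i show "lookup c i = lookup c' i"
      proof (cases "i \<in> {1..n}")
        case True
        then show ?thesis
          using fun_cong[OF eq, of i] by simp
      next
        case False
        then show ?thesis
          using c lookup_outside[of _ n i] by (simp add: expo_cube_def)
      qed
    qed
  qed
  moreover have "?f ` expo_cube n m \<subseteq> {1..n} \<rightarrow>\<^sub>E {..m}"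
    by (auto simp: expo_cube_def)
  ultimately have "card (expo_cube n m) \<le> card ({1..n} \<rightarrow>\<^sub>E {..m})"
    by (rule card_inj_on_le) (intro finite_PiE; simp)
  then show ?thesis
    by (simp add: card_funcsetE)
qed

lemma expo_cube_mono: "m \<le> m' \<Longrightarrow> expo_cube n m \<subseteq> expo_cube n m'"
  by (auto simp: expo_cube_def intro: order_trans)

lemma supported_expo_cube_mult:
  assumes "p \<in> supported (expo_cube n k)" and "q \<in> supported (expo_cube n m)"
  shows "p * q \<in> supported (expo_cube n (k + m))"
proof -
  have "sumset (expo_cube n k) (expo_cube n m) \<subseteq> expo_cube n (k + m)"
    using submonoid_expo[of n]
    by (auto simp: sumset_def expo_cube_def submonoid_set_def lookup_add intro!: add_mono)
  then show ?thesis
    using supported_mult[OF assms] supported_mono by blast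
qed

lemma power_product_expo_cube:
  fixes x :: "nat \<Rightarrow> (nat \<Rightarrow>\<^sub>0 nat) \<Rightarrow>\<^sub>0 'k::comm_ring_1"
  shows "(\<And>i. i < length e \<Longrightarrow> x i \<in> supported (expo_cube n m)) \<Longrightarrow>
    power_product x e \<in> supported (expo_cube n (m * sum_list e))"
proof (induction e arbitrary: x)
  case Nil
  have "0 \<in> expo_cube n 0"
    using submonoid_expo[of n] by (simp add: expo_cube_def submonoid_set_def)
  then show ?case
    by (simp add: supported_def)
next
  case (Cons a e)
  have "x 0 ^ a \<in> supported (expo_cube n (m * a))"
  proof (induction a)
    case 0
    have "0 \<in> expo_cube n 0"
      using submonoid_expo[of n] by (simp add: expo_cube_def submonoid_set_def)
    then show ?case
      by (simp add: supported_def)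
  next
    case (Suc a)
    then show ?case
      using supported_expo_cube_mult[of "x 0" n m "x 0 ^ a"] Cons.prems[of 0] by simp
  qed
  moreover have "power_product (\<lambda>i. x (Suc i)) e \<in> supported (expo_cube n (m * sum_list e))"
    using Cons.prems by (intro Cons.IH) simp
  ultimately show ?case
    using supported_expo_cube_mult[of "x 0 ^ a" n "m * a"] by (simp add: distrib_left)
qed

text \<open>
There are $N^{n+1}$ power products of $x_0, \ldots, x_n$ with exponents below \<open>N\<close>, and they live in a
space of dimension $O(N^n)$, since degrees grow linearly with the exponents.
\<close>

lemma algebraically_dependent:
  fixes x :: "nat \<Rightarrow> (nat \<Rightarrow>\<^sub>0 nat) \<Rightarrow>\<^sub>0 'k::field"
  assumes x: "\<And>i. i \<le> n \<Longrightarrow> x i \<in> supported (expo n)"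
  shows "\<exists>E q. finite E \<and> E \<noteq> {} \<and> (\<forall>e\<in>E. length e = Suc n \<and> q e \<noteq> 0) \<and>
    (\<Sum>e\<in>E. single 0 (q e) * power_product x e) = 0"
proof -
  have "\<exists>m. x i \<in> supported (expo_cube n m)" if "i \<le> n" for i
  proof -
    define m where "m = Max (insert 0 (\<Union>c\<in>keys (x i). lookup c ` {1..n}))"
    have "c \<in> expo_cube n m" if c: "c \<in> keys (x i)" for c
    proof -
      have "c \<in> expo n"
        using x[OF \<open>i \<le> n\<close>] c by (auto simp: supported_def)
      moreover have "lookup c j \<le> m" for j
      proof (cases "j \<in> {1..n}")
        case True
        then have "lookup c j \<in> (\<Union>c\<in>keys (x i). lookup c ` {1..n})"
          using c by blast
        then show ?thesis
          unfolding m_def by (intro Max_ge) simp_all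
      next
        case False
        then show ?thesis
          using lookup_outside[OF \<open>c \<in> expo n\<close>] by simp
      qed
      ultimately show ?thesis
        by (simp add: expo_cube_def)
    qed
    then show ?thesis
      by (auto simp: supported_def)
  qed
  then have "\<forall>i\<in>{..n}. \<exists>m. x i \<in> supported (expo_cube n m)"
    by simp
  from bchoice[OF this] obtain m where m: "\<forall>i\<in>{..n}. x i \<in> supported (expo_cube n (m i))" ..
  define D where "D = Max (m ` {..n})"
  have xD: "x i \<in> supported (expo_cube n D)" if "i \<le> n" for i
  proof -
    have "m i \<le> D"
      unfolding D_def using that by (intro Max_ge) auto
    then show ?thesis
      using m that supported_mono[OF expo_cube_mono] by blast
  qed
  \<comment> \<open>All exponents that occur are below \<open>K * N\<close>, and \<open>N > K ^ n\<close> gives \<open>N ^ (n + 1) > (K * N) ^ n\<close>.\<close>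
  define K where "K = D * (n + 1) + 1"
  define N where "N = K ^ n + 1"
  let ?I = "{e :: nat list. set e \<subseteq> {..<N} \<and> length e = Suc n}"
  define W where "W = expo_cube n (D * (Suc n * N))"
  have finI: "finite ?I"
    by (rule finite_lists_length_eq) simp
  have bound: "sum_list e \<le> length e * N" if "set e \<subseteq> {..<N}" for e
    using that by (induction e) auto
  have keys: "power_product x e \<in> supported W" if e: "e \<in> ?I" for e
  proof -
    have "sum_list e \<le> Suc n * N"
      using bound[of e] e by simp
    then have "D * sum_list e \<le> D * (Suc n * N)"
      by (rule mult_le_mono2)
    moreover have "power_product x e \<in> supported (expo_cube n (D * sum_list e))"
      using e xD by (intro power_product_expo_cube) simp
    ultimately show ?thesis
      unfolding W_def using supported_mono[OF expo_cube_mono] by blast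
  qed
  have "card W < card ?I"
  proof -
    have "D * (Suc n * N) + 1 \<le> K * N"
      by (simp add: K_def N_def algebra_simps)
    then have "(D * (Suc n * N) + 1) ^ n \<le> (K * N) ^ n"
      by (rule power_mono) simp
    then have "card W \<le> K ^ n * N ^ n"
      using card_expo_cube[of n "D * (Suc n * N)"] by (simp add: W_def power_mult_distrib)
    also have "\<dots> < N * N ^ n"
      by (simp add: N_def)
    also have "\<dots> = card ?I"
      by (simp add: card_lists_length_eq)
    finally show ?thesis .
  qed
  then obtain q where q: "\<exists>e\<in>?I. q e \<noteq> 0" "\<forall>w\<in>W. (\<Sum>e\<in>?I. q e * lookup (power_product x e) w) = 0"
    using homogeneous_system_nonzero_solution[of W ?I "\<lambda>e. lookup (power_product x e)"] finI finite_expo_cube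
    unfolding W_def by blast
  define E where "E = {e \<in> ?I. q e \<noteq> 0}"
  have "(\<Sum>e\<in>E. single 0 (q e) * power_product x e) = 0"
  proof (rule poly_mapping_eqI)
    fix c
    have "lookup (\<Sum>e\<in>E. single 0 (q e) * power_product x e) c = (\<Sum>e\<in>E. q e * lookup (power_product x e) c)"
      by (simp add: lookup_sum lookup_single_0_mult)
    also have "\<dots> = (\<Sum>e\<in>?I. q e * lookup (power_product x e) c)"
      unfolding E_def using finI by (intro sum.mono_neutral_left) auto
    also have "\<dots> = 0"
    proof (cases "c \<in> W")
      case True
      then show ?thesis
        using q(2) by blast
    next
      case False
      then have "lookup (power_product x e) c = 0" if "e \<in> ?I" for e
        using keys[OF that] unfolding supported_def mem_Collect_eq by (meson in_keys_iff subsetD)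
      then show ?thesis
        by (intro sum.neutral) simp
    qed
    finally show "lookup (\<Sum>e\<in>E. single 0 (q e) * power_product x e) c = lookup 0 c"
      by simp
  qed
  moreover have "finite E"
    unfolding E_def using finI by (rule rev_finite_subset) blast
  moreover have "E \<noteq> {}" "\<forall>e\<in>E. length e = Suc n \<and> q e \<noteq> 0"
    using q(1) by (auto simp: E_def)
  ultimately show ?thesis
    by blast
qed

theorem krull_dim_le_num_variables:
  assumes M: "submonoid_set M" "M \<subseteq> expo n"
  shows "krull_dim (subring_of (supported M :: ((nat \<Rightarrow>\<^sub>0 nat) \<Rightarrow>\<^sub>0 'k::field) set)) \<le> enat n"
  unfolding krull_dim_def
proof (rule Sup_least, clarify)
  let ?C = "supported M :: ((nat \<Rightarrow>\<^sub>0 nat) \<Rightarrow>\<^sub>0 'k) set"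
  have C: "subring_closed ?C"
    by (rule subring_closed_supported[OF M(1)])
  fix r P
  assume prime: "\<forall>i\<le>r. primeideal (P i) (subring_of ?C)" and chain: "\<forall>i<r. P i \<subset> P (Suc i)"
  have "r \<le> n"
  proof (rule ccontr)
    assume "\<not> r \<le> n"
    then have r: "Suc n \<le> r"
      by simp
    have "\<forall>i\<in>{..n}. \<exists>y. y \<in> P (Suc i) - P i"
    proof
      fix i assume "i \<in> {..n}"
      then have "P i \<subset> P (Suc i)"
        using chain r by simp
      then show "\<exists>y. y \<in> P (Suc i) - P i"
        by (rule psubset_imp_ex_mem)
    qed
    from bchoice[OF this] obtain x where x: "\<forall>i\<in>{..n}. x i \<in> P (Suc i) - P i" ..
    have "x i \<in> supported (expo n)" if "i \<le> n" for i
    proof -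
      have "P (Suc i) \<subseteq> ?C"
        using prime r that unfolding primeideal_subring_of_iff[OF C] ideal_subring_of_iff[OF C] by simp
      then show ?thesis
        using x that supported_mono[OF M(2)] by fastforce
    qed
    then obtain E q where E: "finite E" "E \<noteq> {}" "\<forall>e\<in>E. length e = Suc n \<and> q e \<noteq> 0"
      "(\<Sum>e\<in>E. single 0 (q e) * power_product x e) = 0"
      using algebraically_dependent[of n x] by blast
    have "(\<Sum>e\<in>E. single 0 (q e) * power_product x e) \<notin> P 0"
    proof (rule prime_chain_no_relation[OF C, where r = "Suc n"])
      show "single 0 s \<in> ?C" for s
        using M(1) by (simp add: single_in_supported submonoid_set_def)
      show "P i \<subseteq> P (Suc i)" if "i < Suc n" for i
        using chain r that by (intro psubset_imp_subset) simp
    qed (use prime r x E in \<open>simp_all add: mult_single\<close>)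
    moreover have "0 \<in> P 0"
      using prime unfolding primeideal_subring_of_iff[OF C] ideal_subring_of_iff[OF C] by simp
    ultimately show False
      using E(4) by simp
  qed
  then show "enat r \<le> enat n"
    by simp
qed

text \<open>
The polynomials without terms in a face \<open>F\<close> of \<open>M\<close> form the kernel of the projection onto the span
of \<open>F\<close>. This projection is multiplicative with values in a domain, so its kernel is prime, and
smaller faces give larger primes.
\<close>

theorem krull_dim_ge_length_face_chain:
  fixes F :: "nat \<Rightarrow> (nat \<Rightarrow>\<^sub>0 nat) set"
  assumes M: "submonoid_set M" and sub: "\<And>i. i \<le> r \<Longrightarrow> F i \<subseteq> M" and zero: "\<And>i. i \<le> r \<Longrightarrow> 0 \<in> F i"
    and face: "\<And>i a b. i \<le> r \<Longrightarrow> a \<in> M \<Longrightarrow> b \<in> M \<Longrightarrow> a + b \<in> F i \<longleftrightarrow> a \<in> F i \<and> b \<in> F i"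
    and chain: "\<And>i. i < r \<Longrightarrow> F (Suc i) \<subset> F i"
  shows "enat r \<le> krull_dim (subring_of (supported M :: ((nat \<Rightarrow>\<^sub>0 nat) \<Rightarrow>\<^sub>0 'k::field) set))"
proof -
  let ?C = "supported M :: ((nat \<Rightarrow>\<^sub>0 nat) \<Rightarrow>\<^sub>0 'k) set"
  have C: "subring_closed ?C"
    by (rule subring_closed_supported[OF M])
  define P :: "nat \<Rightarrow> ((nat \<Rightarrow>\<^sub>0 nat) \<Rightarrow>\<^sub>0 'k) set" where "P i = supported (M - F i)" for i
  have "primeideal (P i) (subring_of ?C)" if i: "i \<le> r" for i
    unfolding primeideal_subring_of_iff[OF C]
  proof (intro conjI ballI impI)
    have "sumset M (M - F i) \<subseteq> M - F i"
      using face[OF i] M by (auto simp: sumset_def submonoid_set_def)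
    then show "ideal (P i) (subring_of ?C)"
      unfolding P_def by (intro ideal_supported[OF M]) auto
    show "1 \<notin> P i"
      using zero[OF i] by (simp add: P_def supported_def)
    fix p q assume pq: "p \<in> ?C" "q \<in> ?C" "p * q \<in> P i"
    have "restrict_keys (F i) (p * q) = restrict_keys (F i) p * restrict_keys (F i) q"
      using pq(1,2) face[OF i] by (intro restrict_keys_mult) (auto simp: supported_def)
    moreover have "restrict_keys (F i) (p * q) = 0"
      using pq(3) by (auto simp: P_def supported_def simp flip: restrict_keys_eq_0)
    ultimately have "restrict_keys (F i) p = 0 \<or> restrict_keys (F i) q = 0"
      by simp
    then show "p \<in> P i \<or> q \<in> P i"
      using pq(1,2) by (auto simp: P_def supported_def simp flip: restrict_keys_eq_0)
  qed
  moreover have "P i \<subset> P (Suc i)" if i: "i < r" for i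
  proof -
    obtain c where c: "c \<in> F i" "c \<notin> F (Suc i)"
      using chain[OF i] by blast
    then have "c \<in> M"
      using sub[of i] i by auto
    have "monomial c \<in> P (Suc i) - P i"
      using c \<open>c \<in> M\<close> by (simp add: P_def supported_def keys_monomial)
    moreover have "P i \<subseteq> P (Suc i)"
      unfolding P_def using chain[OF i] by (intro supported_mono) blast
    ultimately show ?thesis
      by blast
  qed
  ultimately show ?thesis
    unfolding krull_dim_def by (intro Sup_upper) blast
qed

section \<open>The fiber cone\<close>

text \<open>
Chains of primes are pulled back along \<open>h\<close>; surjectivity keeps their inclusions strict.
\<close>

lemma krull_dim_le_of_surj_hom:
  assumes "cring R" "cring S" and h: "h \<in> ring_hom R S" and surj: "h ` carrier R = carrier S"
  shows "krull_dim S \<le> krull_dim R"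
proof -
  interpret ring_hom_cring R S h
    using assms by (simp add: ring_hom_cring_def ring_hom_cring_axioms_def)
  let ?v = "\<lambda>P. {a \<in> carrier R. h a \<in> P}"
  have prime: "primeideal (?v P) R" if P: "primeideal P S" for P
  proof (rule primeidealI)
    interpret P: primeideal P S by (rule P)
    show "ideal (?v P) R"
      by (rule ring.ideal_vimage[OF P.is_ideal])
    show "cring R"
      by (rule assms(1))
    show "carrier R \<noteq> ?v P"
    proof
      assume eq: "carrier R = ?v P"
      have "h a \<in> P" if "a \<in> carrier R" for a
        using that by (subst (asm) eq) simp
      then have "carrier S \<subseteq> P"
        unfolding surj[symmetric] by (rule image_subsetI)
      then show False
        using P.I_notcarr P.a_subset by simp
    qed
    show "a \<in> ?v P \<or> b \<in> ?v P" if "a \<in> carrier R" "b \<in> carrier R" "a \<otimes>\<^bsub>R\<^esub> b \<in> ?v P" for a b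
      using P.I_prime[of "h a" "h b"] that by auto
  qed
  have strict: "?v P \<subset> ?v Q" if "P \<subset> Q" "Q \<subseteq> carrier S" for P Q
  proof -
    obtain s where s: "s \<in> Q" "s \<notin> P"
      using \<open>P \<subset> Q\<close> by blast
    have "s \<in> h ` carrier R"
      unfolding surj using s(1) \<open>Q \<subseteq> carrier S\<close> by (rule subsetD[rotated])
    then obtain a where "a \<in> carrier R" "h a = s"
      by blast
    then show ?thesis
      using s \<open>P \<subset> Q\<close> by blast
  qed
  show ?thesis
    unfolding krull_dim_def
  proof (rule Sup_subset_mono, clarify)
    fix r P
    assume P: "\<forall>i\<le>r. primeideal (P i) S" "\<forall>i<r. P i \<subset> P (Suc i)"
    have "P (Suc i) \<subseteq> carrier S" if "i < r" for i
    proof -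
      have "primeideal (P (Suc i)) S"
        using P(1) that by simp
      then show ?thesis
        by (intro subsetI ideal.Icarr[OF primeideal.axioms(1)])
    qed
    then have "\<forall>i\<le>r. primeideal (?v (P i)) R" "\<forall>i<r. ?v (P i) \<subset> ?v (P (Suc i))"
      using P prime strict by simp_all
    then show "\<exists>ra. enat r = enat ra \<and> (\<exists>P. (\<forall>i\<le>ra. primeideal (P i) R) \<and> (\<forall>i<ra. P i \<subset> P (Suc i)))"
      by (intro exI[of _ r] conjI refl exI[of _ "\<lambda>i. ?v (P i)"])
  qed
qed

lemma krull_dim_iso:
  assumes "cring R" "cring S" and h: "h \<in> ring_iso R S"
  shows "krull_dim R = krull_dim S"
proof (rule antisym)
  have "ring R"
    using assms(1) by (rule cring.axioms)
  have "inv_into (carrier R) h \<in> ring_iso S R"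
    by (rule ring_iso_set_sym[OF \<open>ring R\<close> h])
  then show "krull_dim R \<le> krull_dim S"
    using assms(1,2) by (intro krull_dim_le_of_surj_hom[of S R "inv_into (carrier R) h"])
      (auto simp: ring_iso_def bij_betw_def)
  show "krull_dim S \<le> krull_dim R"
    using assms by (intro krull_dim_le_of_surj_hom[of R S h]) (auto simp: ring_iso_def bij_betw_def)
qed

lemma sum_in_supported: "(\<And>i. i \<in> A \<Longrightarrow> f i \<in> supported E) \<Longrightarrow> sum f A \<in> supported E"
  by (induction A rule: infinite_finite_induct) (auto intro: supported_add zero_in_supported)

lemma sumset_interchange:
  "sumset (sumset A B) (sumset C D) = sumset (sumset A C) (sumset B (D :: 'm::ab_semigroup_add set))"
proof -
  have "sumset B (sumset C D) = sumset C (sumset B D)"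
    by (simp only: sumset_assoc[symmetric] sumset_commute[of B C])
  then show ?thesis
    by (simp only: sumset_assoc)
qed

text \<open>
The nonzero exponents are those that can be lowered by one in some coordinate.
\<close>

lemma max_ideal_eq: "max_ideal n = (supported (expo n - {0}) :: ((nat \<Rightarrow>\<^sub>0 nat) \<Rightarrow>\<^sub>0 'k::field) set)"
proof -
  let ?E = "(\<lambda>i. single i (1::nat)) ` {1..n}"
  have E: "?E \<subseteq> expo n"
    by (auto simp: expo_def)
  have "max_ideal n = Idl\<^bsub>mpoly_ring n\<^esub> ((monomial :: _ \<Rightarrow> (nat \<Rightarrow>\<^sub>0 nat) \<Rightarrow>\<^sub>0 'k) ` ?E)"
    by (simp only: max_ideal_def image_image)
  also have "\<dots> = supported (sumset (expo n) ?E)"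
    unfolding mpoly_ring_eq by (rule genideal_monomials[OF submonoid_expo E])
  also have "sumset (expo n) ?E = expo n - {0}"
  proof (intro equalityI subsetI)
    fix c assume "c \<in> sumset (expo n) ?E"
    then obtain a i where c: "c = a + single i 1" "a \<in> expo n" "i \<in> {1..n}"
      by (auto simp: sumset_def)
    then have "lookup c i \<noteq> 0"
      by (simp add: lookup_add)
    moreover have "c \<in> expo n"
      using c E submonoid_expo[of n] unfolding submonoid_set_def by blast
    ultimately show "c \<in> expo n - {0}"
      by auto
  next
    fix c assume c: "c \<in> expo n - {0}"
    then obtain i where i: "lookup c i \<noteq> 0"
      by (auto simp: poly_mapping_eq_iff fun_eq_iff)
    then have "i \<in> {1..n}"
      using c lookup_outside[of c n i] by auto
    moreover have "c = (c - single i 1) + single i 1"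
      using i by (intro poly_mapping_eqI) (auto simp: lookup_add lookup_minus lookup_single when_def)
    moreover have "c - single i 1 \<in> expo n"
      using c by (auto simp: expo_def in_keys_iff lookup_minus subset_iff)
    ultimately show "c \<in> sumset (expo n) ?E"
      unfolding sumset_def by blast
  qed
  finally show ?thesis .
qed

definition generated_monoid :: "'m::comm_monoid_add set \<Rightarrow> 'm set"
  where "generated_monoid B = (\<Union>j. multisum B j)"

lemma submonoid_generated: "submonoid_set (generated_monoid B)"
  unfolding submonoid_set_def generated_monoid_def
proof (intro conjI ballI)
  show "0 \<in> (\<Union>j. multisum B j)"
    by (rule UN_I[of 0]) simp_all
  fix a b assume "a \<in> (\<Union>j. multisum B j)" "b \<in> (\<Union>j. multisum B j)"
  then obtain i j where "a \<in> multisum B i" "b \<in> multisum B j"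
    by blast
  then have "a + b \<in> multisum B (i + j)"
    unfolding multisum_add sumset_def by blast
  then show "a + b \<in> (\<Union>j. multisum B j)"
    by blast
qed

lemma generated_monoid_subset: "submonoid_set A \<Longrightarrow> B \<subseteq> A \<Longrightarrow> generated_monoid B \<subseteq> A"
  unfolding generated_monoid_def using multisum_subset by blast

text \<open>
The type argument fixes the coefficient field, which neither \<open>d\<close> nor \<open>B\<close> determines. In this context
\<open>E j\<close> is the set of exponents of the monomials in the \<open>j\<close>-th power of \<open>I\<close>.
\<close>

locale equigenerated =
  fixes n d :: nat and B :: "(nat \<Rightarrow>\<^sub>0 nat) set" and ty :: "'k::field itself"
  assumes B: "B \<subseteq> exponents n d" and d: "0 < d"
begin

abbreviation "R \<equiv> mpoly_ring n :: ((nat \<Rightarrow>\<^sub>0 nat) \<Rightarrow>\<^sub>0 'k) ring"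
abbreviation "I \<equiv> Idl\<^bsub>R\<^esub> (monomial ` B)"
abbreviation "E j \<equiv> sumset (expo n) (multisum B j)"
abbreviation "T \<equiv> subring_of (supported (generated_monoid B) :: ((nat \<Rightarrow>\<^sub>0 nat) \<Rightarrow>\<^sub>0 'k) set)"

lemma B_expo: "B \<subseteq> expo n"
  using B exponents_subset_expo by blast

lemma power_I: "ideal_power R I j = supported (E j)"
  unfolding mpoly_ring_eq by (rule ideal_power_monomials[OF submonoid_expo B_expo])

lemma multisum_expo: "multisum B j \<subseteq> expo n"
  by (rule multisum_subset[OF submonoid_expo B_expo])

lemma tdeg_multisum: "c \<in> multisum B j \<Longrightarrow> tdeg n c = j * d"
proof (induction j arbitrary: c)
  case (Suc j)
  then obtain a b where "c = a + b" "a \<in> multisum B j" "b \<in> B"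
    by (auto simp: sumset_def)
  then show ?case
    using Suc.IH[of a] B by (auto simp: tdeg_add exponents_eq)
qed simp

lemma multisum_subset_E: "multisum B j \<subseteq> E j"
proof
  fix c assume "c \<in> multisum B j"
  then have "0 + c \<in> E j"
    using submonoid_expo[of n] unfolding sumset_def submonoid_set_def by blast
  then show "c \<in> E j"
    by simp
qed

lemma E_expo: "E j \<subseteq> expo n"
  using multisum_expo submonoid_expo[of n] by (fastforce simp: sumset_def submonoid_set_def)

text \<open>
The monomials in the \<open>j\<close>-th power of \<open>I\<close> have degree at least \<open>j * d\<close>, and the elements of \<open>jB\<close> are
exactly those of least degree. Degrees thus decide membership in \<open>jB\<close>.
\<close>

lemma E_cases:
  assumes "c \<in> E j"
  shows "c \<in> multisum B j \<and> tdeg n c = j * d \<or> c \<notin> multisum B j \<and> j * d < tdeg n c"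
proof -
  obtain a b where c: "c = a + b" "a \<in> expo n" "b \<in> multisum B j"
    using assms by (auto simp: sumset_def)
  show ?thesis
  proof (cases "a = 0")
    case True
    then show ?thesis
      using c tdeg_multisum by simp
  next
    case False
    then have "j * d < tdeg n c"
      using c tdeg_multisum[OF c(3)] tdeg_eq_0[OF c(2)] by (simp add: tdeg_add)
    then show ?thesis
      using tdeg_multisum[of c j] by auto
  qed
qed

lemma max_ideal_prod: "ideal_prod R (max_ideal n) (ideal_power R I j) = supported (E j - multisum B j)"
proof -
  have "sumset (expo n - {0}) (E j) = E j - multisum B j"
  proof (intro equalityI subsetI)
    fix c assume "c \<in> sumset (expo n - {0}) (E j)"
    then obtain a b where c: "c = a + b" "a \<in> expo n" "a \<noteq> 0" "b \<in> E j"
      by (auto simp: sumset_def)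
    have "tdeg n a > 0" "tdeg n b \<ge> j * d"
      using c tdeg_eq_0 E_cases[of b j] by auto
    then have "c \<notin> multisum B j"
      using tdeg_multisum[of c j] by (auto simp: c(1) tdeg_add)
    moreover have "c \<in> sumset (expo n) (E j)"
      using c unfolding sumset_def by blast
    then have "c \<in> E j"
      by (simp add: sumset_self submonoid_expo flip: sumset_assoc)
    ultimately show "c \<in> E j - multisum B j"
      by blast
  next
    fix c assume c: "c \<in> E j - multisum B j"
    then obtain a b where ab: "c = a + b" "a \<in> expo n" "b \<in> multisum B j"
      by (auto simp: sumset_def)
    then have "a \<noteq> 0"
      using c by auto
    then show "c \<in> sumset (expo n - {0}) (E j)"
      using ab multisum_subset_E unfolding sumset_def[of "expo n - {0}"] by blast
  qed
  then show ?thesis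
    by (simp only: power_I max_ideal_eq) (simp only: mpoly_ring_eq ideal_prod_supported)
qed

lemma multisum_prod_face:
  assumes "a \<in> E i" "b \<in> E j"
  shows "a + b \<in> multisum B (i + j) \<longleftrightarrow> a \<in> multisum B i \<and> b \<in> multisum B j"
proof
  assume "a + b \<in> multisum B (i + j)"
  then have "tdeg n a + tdeg n b = i * d + j * d"
    using tdeg_multisum by (simp add: tdeg_add[symmetric] add_mult_distrib)
  then show "a \<in> multisum B i \<and> b \<in> multisum B j"
    using E_cases[OF assms(1)] E_cases[OF assms(2)] by linarith
next
  assume "a \<in> multisum B i \<and> b \<in> multisum B j"
  then show "a + b \<in> multisum B (i + j)"
    unfolding multisum_add sumset_def by blast
qed

lemma multisum_disjoint:
  assumes "i \<noteq> j"
  shows "multisum B i \<inter> multisum B j = {}"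
proof (rule Int_emptyI)
  fix c assume "c \<in> multisum B i" "c \<in> multisum B j"
  then have "i * d = j * d"
    using tdeg_multisum by metis
  then show False
    using assms d by simp
qed

lemma R_cring: "cring R"
  unfolding mpoly_ring_eq by (rule cring_subring_of[OF subring_closed_supported[OF submonoid_expo]])

lemma finsum_R: "(\<And>i. i \<in> A \<Longrightarrow> f i \<in> carrier R) \<Longrightarrow> finsum R f A = sum f A"
  unfolding mpoly_ring_eq
  using finsum_subring_of[OF subring_closed_supported[OF submonoid_expo], of A f] by simp

abbreviation "Rees \<equiv> rees_ring R I"

lemma carrier_Rees_iff:
  "f \<in> carrier Rees \<longleftrightarrow> (\<forall>j. f j \<in> supported (E j)) \<and> (\<exists>N. \<forall>j>N. f j = 0)"
proof -
  have "supported (E j) \<subseteq> (supported (expo n) :: ((nat \<Rightarrow>\<^sub>0 nat) \<Rightarrow>\<^sub>0 'k) set)" for j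
    by (rule supported_mono[OF E_expo])
  then show ?thesis
    unfolding rees_ring_def power_I by (auto simp: UP_def up_def mpoly_ring_eq bound_def)
qed

lemma Rees_in_UP: "f \<in> carrier Rees \<Longrightarrow> f \<in> up R"
  by (simp add: rees_ring_def UP_def)

lemma Rees_mult:
  assumes "f \<in> carrier Rees" "g \<in> carrier Rees"
  shows "(f \<otimes>\<^bsub>Rees\<^esub> g) m = (\<Sum>i\<le>m. f i * g (m - i))"
proof -
  have "(f \<otimes>\<^bsub>Rees\<^esub> g) m = (\<Oplus>\<^bsub>R\<^esub>i\<in>{..m}. f i \<otimes>\<^bsub>R\<^esub> g (m - i))"
    using Rees_in_UP[OF assms(1)] Rees_in_UP[OF assms(2)] by (simp add: rees_ring_def UP_def)
  also have "\<dots> = (\<Sum>i\<le>m. f i \<otimes>\<^bsub>R\<^esub> g (m - i))"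
    using Rees_in_UP[OF assms(1)] Rees_in_UP[OF assms(2)] R_cring
    by (intro finsum_R) (auto intro: monoid.m_closed[OF ring.is_monoid[OF cring.axioms(1)]])
  finally show ?thesis
    by (simp add: mpoly_ring_eq)
qed

lemma Rees_add:
  assumes "f \<in> carrier Rees" "g \<in> carrier Rees"
  shows "(f \<oplus>\<^bsub>Rees\<^esub> g) m = f m + g m"
  using Rees_in_UP[OF assms(1)] Rees_in_UP[OF assms(2)]
  by (simp add: rees_ring_def UP_def mpoly_ring_eq)

lemma Rees_one: "\<one>\<^bsub>Rees\<^esub> m = (if m = 0 then 1 else 0)"
  by (simp add: rees_ring_def UP_def mpoly_ring_eq)

lemma coeff_UP: "f \<in> carrier (UP R) \<Longrightarrow> up_ring.coeff (UP R) f m = f m"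
  by (simp add: UP_def)

lemma Rees_cring: "cring Rees"
proof -
  interpret R: cring R
    by (rule R_cring)
  interpret UP_cring R "UP R"
    by unfold_locales
  have carr: "carrier Rees = {f \<in> carrier (UP R). \<forall>j. f j \<in> supported (E j)}"
    by (simp add: rees_ring_def power_I)
  have Rees_eq: "Rees = (UP R)\<lparr>carrier := carrier Rees\<rparr>"
    by (simp add: rees_ring_def)
  have "subring (carrier Rees) (UP R)"
  proof (rule ring.subringI[OF P.ring_axioms])
    show "carrier Rees \<subseteq> carrier (UP R)"
      by (auto simp: carr)
    show "\<one>\<^bsub>UP R\<^esub> \<in> carrier Rees"
    proof -
      have "0 \<in> expo n"
        using submonoid_expo[of n] by (simp add: submonoid_set_def)
      then have "\<one>\<^bsub>Rees\<^esub> j \<in> supported (E j)" for j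
        by (simp add: Rees_one zero_in_supported) (simp add: supported_def)
      moreover have "\<one>\<^bsub>Rees\<^esub> = \<one>\<^bsub>UP R\<^esub>"
        by (simp add: rees_ring_def)
      ultimately show ?thesis
        by (simp add: carr)
    qed
    show "\<ominus>\<^bsub>UP R\<^esub> f \<in> carrier Rees" if f: "f \<in> carrier Rees" for f
    proof -
      have fU: "f \<in> carrier (UP R)" and fE: "\<And>j. f j \<in> supported (E j)"
        using f by (auto simp: carr)
      have "(\<ominus>\<^bsub>UP R\<^esub> f) j \<in> supported (E j)" for j
      proof -
        have "(\<ominus>\<^bsub>UP R\<^esub> f) j = \<ominus>\<^bsub>R\<^esub> f j"
          using coeff_a_inv[OF fU, of j] coeff_UP[OF fU] coeff_UP[OF P.a_inv_closed[OF fU]] by simp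
        also have "\<dots> = - f j"
          using a_inv_subring_of[OF subring_closed_supported[OF submonoid_expo], of "f j" n] fE[of j]
            supported_mono[OF E_expo] unfolding mpoly_ring_eq by blast
        finally show ?thesis
          using fE[of j] by (simp add: supported_def)
      qed
      then show ?thesis
        using fU by (simp add: carr)
    qed
    show "f \<otimes>\<^bsub>UP R\<^esub> g \<in> carrier Rees" if fg: "f \<in> carrier Rees" "g \<in> carrier Rees" for f g
    proof -
      have "f i * g (m - i) \<in> supported (E m)" if "i \<le> m" for i m
      proof -
        have "sumset (E i) (E (m - i)) = sumset (sumset (expo n) (expo n)) (sumset (multisum B i) (multisum B (m - i)))"
          by (rule sumset_interchange)
        also have "\<dots> = E m"
          using that by (simp add: sumset_self submonoid_expo flip: multisum_add)
        finally show ?thesis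
          using supported_mult[of "f i" "E i" "g (m - i)" "E (m - i)"] fg carr by simp
      qed
      then have "(\<Sum>i\<le>m. f i * g (m - i)) \<in> supported (E m)" for m
        by (intro sum_in_supported) simp
      then have "\<And>m. (f \<otimes>\<^bsub>Rees\<^esub> g) m \<in> supported (E m)"
        using Rees_mult[OF fg] by simp
      moreover have "f \<otimes>\<^bsub>Rees\<^esub> g = f \<otimes>\<^bsub>UP R\<^esub> g"
        by (simp add: rees_ring_def)
      moreover have "f \<otimes>\<^bsub>UP R\<^esub> g \<in> carrier (UP R)"
        using fg carr by simp
      ultimately show ?thesis
        by (simp add: carr)
    qed
    show "f \<oplus>\<^bsub>UP R\<^esub> g \<in> carrier Rees" if fg: "f \<in> carrier Rees" "g \<in> carrier Rees" for f g
    proof -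
      have "\<And>m. (f \<oplus>\<^bsub>Rees\<^esub> g) m \<in> supported (E m)"
        using Rees_add[OF fg] fg by (simp add: carr supported_add)
      moreover have "f \<oplus>\<^bsub>Rees\<^esub> g = f \<oplus>\<^bsub>UP R\<^esub> g"
        by (simp add: rees_ring_def)
      moreover have "f \<oplus>\<^bsub>UP R\<^esub> g \<in> carrier (UP R)"
        using fg carr by simp
      ultimately show ?thesis
        by (simp add: carr)
    qed
  qed
  then have "subcring (carrier Rees) (UP R)"
    by (rule cring.subcringI'[OF P.cring_axioms])
  then show ?thesis
    using ring.subcring_iff[OF P.ring_axioms, of "carrier Rees"] Rees_eq carr by auto
qed

text \<open>
For $f = \sum_j f_j t^j$ in the Rees ring, $f_j$ has no terms of degree below \<open>j * d\<close>. The sum below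
collects the terms of the $f_j$ of exactly this degree, which are those with exponent in \<open>jB\<close>.
\<close>

definition initial_part :: "(nat \<Rightarrow> (nat \<Rightarrow>\<^sub>0 nat) \<Rightarrow>\<^sub>0 'k) \<Rightarrow> (nat \<Rightarrow>\<^sub>0 nat) \<Rightarrow>\<^sub>0 'k"
  where "initial_part f = (\<Sum>j | f j \<noteq> 0. restrict_keys (multisum B j) (f j))"

lemma initial_part_eq:
  assumes "\<And>j. N < j \<Longrightarrow> f j = 0"
  shows "initial_part f = (\<Sum>j\<le>N. restrict_keys (multisum B j) (f j))"
  unfolding initial_part_def
proof (rule sum.mono_neutral_left)
  show "{j. f j \<noteq> 0} \<subseteq> {..N}"
    using assms by (auto simp: not_less[symmetric])
qed auto

lemma initial_part_supported:
  assumes "f \<in> carrier Rees"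
  shows "initial_part f \<in> supported (generated_monoid B)"
  unfolding initial_part_def
proof (rule sum_in_supported)
  show "restrict_keys (multisum B j) (f j) \<in> supported (generated_monoid B)" for j
    by (auto simp: supported_def keys_restrict_keys generated_monoid_def)
qed

text \<open>
The sets \<open>jB\<close> lie in different degrees, so the summands of \<open>initial_part f\<close> can be recovered from it.
\<close>

lemma restrict_initial_part:
  assumes "f \<in> carrier Rees"
  shows "restrict_keys (multisum B j) (initial_part f) = restrict_keys (multisum B j) (f j)"
proof -
  obtain N where N: "\<And>j. N < j \<Longrightarrow> f j = 0"
    using assms unfolding carrier_Rees_iff by blast
  define N' where "N' = max N j"
  have "initial_part f = (\<Sum>j\<le>N'. restrict_keys (multisum B j) (f j))"
    using N by (intro initial_part_eq) (simp add: N'_def)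
  then have "restrict_keys (multisum B j) (initial_part f)
      = (\<Sum>i\<le>N'. restrict_keys (multisum B j) (restrict_keys (multisum B i) (f i)))"
    by (simp add: restrict_keys_sum)
  also have "\<dots> = (\<Sum>i\<le>N'. if i = j then restrict_keys (multisum B j) (f j) else 0)"
  proof (rule sum.cong[OF refl])
    fix i
    show "restrict_keys (multisum B j) (restrict_keys (multisum B i) (f i))
        = (if i = j then restrict_keys (multisum B j) (f j) else 0)"
      using multisum_disjoint[of i j] by (intro poly_mapping_eqI) (auto simp: lookup_restrict_keys)
  qed
  also have "\<dots> = restrict_keys (multisum B j) (f j)"
    by (simp add: N'_def)
  finally show ?thesis .
qed

lemma initial_part_mult:
  assumes fg: "f \<in> carrier Rees" "g \<in> carrier Rees"
  shows "initial_part (f \<otimes>\<^bsub>Rees\<^esub> g) = initial_part f * initial_part g"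
proof -
  obtain Nf Ng where Nf: "\<And>j. Nf < j \<Longrightarrow> f j = 0" and Ng: "\<And>j. Ng < j \<Longrightarrow> g j = 0"
    using fg unfolding carrier_Rees_iff by blast
  define N where "N = max Nf Ng"
  have zero: "\<And>j. N < j \<Longrightarrow> f j = 0" "\<And>j. N < j \<Longrightarrow> g j = 0"
    using Nf Ng by (simp_all add: N_def)
  let ?f = "\<lambda>j. restrict_keys (multisum B j) (f j)" and ?g = "\<lambda>j. restrict_keys (multisum B j) (g j)"
  have fgE: "keys (f i) \<subseteq> E i" "keys (g i) \<subseteq> E i" for i
    using fg unfolding carrier_Rees_iff supported_def by blast+
  have "(f \<otimes>\<^bsub>Rees\<^esub> g) m = 0" if "2 * N < m" for m
    unfolding Rees_mult[OF fg]
  proof (rule sum.neutral, rule ballI)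
    fix i assume "i \<in> {..m}"
    then have "N < i \<or> N < m - i"
      using that by auto
    then show "f i * g (m - i) = 0"
      using zero by auto
  qed
  then have "initial_part (f \<otimes>\<^bsub>Rees\<^esub> g)
      = (\<Sum>m\<le>2 * N. restrict_keys (multisum B m) (\<Sum>i\<le>m. f i * g (m - i)))"
    by (subst initial_part_eq[of "2 * N"]) (simp_all add: Rees_mult[OF fg])
  also have "\<dots> = (\<Sum>m\<le>2 * N. \<Sum>i\<le>m. ?f i * ?g (m - i))"
    unfolding restrict_keys_sum
  proof (intro sum.cong refl)
    fix m i :: nat assume "i \<in> {..m}"
    then have "restrict_keys (multisum B (i + (m - i))) (f i * g (m - i)) = ?f i * ?g (m - i)"
      using fgE by (intro restrict_keys_mult multisum_prod_face) blast+
    then show "restrict_keys (multisum B m) (f i * g (m - i)) = ?f i * ?g (m - i)"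
      using \<open>i \<in> {..m}\<close> by simp
  qed
  also have "\<dots> = (\<Sum>(i, j)\<in>{(i, j). i + j \<le> 2 * N}. ?f i * ?g j)"
    by (rule sum.triangle_reindex_eq[symmetric])
  also have "\<dots> = (\<Sum>(i, j)\<in>{..N} \<times> {..N}. ?f i * ?g j)"
  proof (rule sum.mono_neutral_right)
    show "finite {(i, j). i + j \<le> 2 * N}"
      by (rule finite_subset[of _ "{..2 * N} \<times> {..2 * N}"]) auto
    show "\<forall>x\<in>{(i, j). i + j \<le> 2 * N} - {..N} \<times> {..N}. (case x of (i, j) \<Rightarrow> ?f i * ?g j) = 0"
    proof
      fix x assume "x \<in> {(i, j). i + j \<le> 2 * N} - {..N} \<times> {..N}"
      then obtain i j where x: "x = (i, j)" "N < i \<or> N < j"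
        by (cases x) (auto simp: not_le)
      then have "f i = 0 \<or> g j = 0"
        using zero by auto
      then show "(case x of (i, j) \<Rightarrow> ?f i * ?g j) = 0"
        by (auto simp: x(1))
    qed
  qed auto
  also have "\<dots> = (\<Sum>i\<le>N. ?f i) * (\<Sum>j\<le>N. ?g j)"
    by (simp add: sum_product sum.cartesian_product)
  also have "\<dots> = initial_part f * initial_part g"
    by (simp only: initial_part_eq[of N f, OF zero(1)] initial_part_eq[of N g, OF zero(2)])
  finally show ?thesis .
qed

lemma initial_part_add:
  assumes fg: "f \<in> carrier Rees" "g \<in> carrier Rees"
  shows "initial_part (f \<oplus>\<^bsub>Rees\<^esub> g) = initial_part f + initial_part g"
proof -
  obtain Nf Ng where Nf: "\<And>j. Nf < j \<Longrightarrow> f j = 0" and Ng: "\<And>j. Ng < j \<Longrightarrow> g j = 0"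
    using fg unfolding carrier_Rees_iff by blast
  define N where "N = max Nf Ng"
  have zero: "\<And>j. N < j \<Longrightarrow> f j = 0" "\<And>j. N < j \<Longrightarrow> g j = 0"
    using Nf Ng by (simp_all add: N_def)
  then show ?thesis
    using fg by (simp add: initial_part_eq[of N] Rees_add restrict_keys_add sum.distrib)
qed

lemma initial_part_one: "initial_part \<one>\<^bsub>Rees\<^esub> = 1"
proof -
  have "initial_part \<one>\<^bsub>Rees\<^esub> = (\<Sum>j\<le>0. restrict_keys (multisum B j) (\<one>\<^bsub>Rees\<^esub> j))"
    by (rule initial_part_eq) (simp add: Rees_one)
  then show ?thesis
    by (simp add: Rees_one restrict_keys_id)
qed

lemma T_cring: "cring T"
  by (rule cring_subring_of[OF subring_closed_supported[OF submonoid_generated]])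

lemma initial_part_hom: "initial_part \<in> ring_hom Rees T"
  using initial_part_supported initial_part_mult initial_part_add initial_part_one
  by (auto simp: ring_hom_def)

lemma initial_part_surj: "initial_part ` carrier Rees = carrier T"
proof (intro equalityI subsetI)
  fix p assume "p \<in> initial_part ` carrier Rees"
  then show "p \<in> carrier T"
    using initial_part_supported by auto
next
  fix p assume "p \<in> carrier T"
  then have p: "keys p \<subseteq> generated_monoid B"
    by (simp add: supported_def)
  define f where "f j = restrict_keys (multisum B j) p" for j
  define N where "N = Max (insert 0 ((\<lambda>c. tdeg n c div d) ` keys p))"
  have level: "tdeg n c div d = j" if "c \<in> multisum B j" for c j
    using tdeg_multisum[OF that] d by simp
  have zero: "f j = 0" if "N < j" for j
  proof -
    have "c \<notin> multisum B j" if "c \<in> keys p" for c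
    proof
      assume "c \<in> multisum B j"
      then have "j \<in> (\<lambda>c. tdeg n c div d) ` keys p"
        using level that by blast
      then have "j \<le> N"
        unfolding N_def by (intro Max_ge) auto
      then show False
        using \<open>N < j\<close> by simp
    qed
    then show ?thesis
      unfolding f_def by (subst restrict_keys_eq_0[symmetric]) blast
  qed
  have f: "f \<in> carrier Rees"
    unfolding carrier_Rees_iff
  proof (intro conjI allI)
    show "f j \<in> supported (E j)" for j
      using multisum_subset_E by (auto simp: f_def supported_def keys_restrict_keys)
    show "\<exists>N. \<forall>j>N. f j = 0"
      using zero by blast
  qed
  have "initial_part f = p"
  proof (rule poly_mapping_eqI)
    fix c
    show "lookup (initial_part f) c = lookup p c"
    proof (cases "c \<in> generated_monoid B")
      case True
      then obtain j where j: "c \<in> multisum B j"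
        by (auto simp: generated_monoid_def)
      have "lookup (initial_part f) c = lookup (restrict_keys (multisum B j) (initial_part f)) c"
        using j by (simp add: lookup_restrict_keys)
      also have "\<dots> = lookup p c"
        unfolding restrict_initial_part[OF f] using j by (simp add: f_def lookup_restrict_keys)
      finally show ?thesis .
    next
      case False
      then have "c \<notin> keys p" "c \<notin> keys (initial_part f)"
        using p initial_part_supported[OF f] by (auto simp: supported_def)
      then show ?thesis
        by (simp add: in_keys_iff)
    qed
  qed
  then show "p \<in> initial_part ` carrier Rees"
    using f by blast
qed

text \<open>
Multiplication with the maximal ideal removes exactly the monomials of least degree from the
\<open>j\<close>-th power of \<open>I\<close>, that is, those that \<open>initial_part\<close> retains.
\<close>

lemma initial_part_kernel:
  "a_kernel Rees T initial_part =
    {f \<in> carrier (UP R). \<forall>j. f j \<in> ideal_prod R (max_ideal n) (ideal_power R I j)}" (is "_ = ?K")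
proof -
  have iff: "f \<in> ?K \<longleftrightarrow> f \<in> carrier Rees \<and> (\<forall>j. restrict_keys (multisum B j) (f j) = 0)" for f
  proof -
    have "keys (f j) \<subseteq> E j - multisum B j \<longleftrightarrow> keys (f j) \<subseteq> E j \<and> restrict_keys (multisum B j) (f j) = 0" for j
      by (subst restrict_keys_eq_0[symmetric]) blast
    then show ?thesis
      unfolding max_ideal_prod by (auto simp: rees_ring_def power_I supported_def)
  qed
  have "initial_part f = 0 \<longleftrightarrow> (\<forall>j. restrict_keys (multisum B j) (f j) = 0)" if f: "f \<in> carrier Rees" for f
  proof
    assume "initial_part f = 0"
    then show "\<forall>j. restrict_keys (multisum B j) (f j) = 0"
      using restrict_initial_part[OF f] by simp
  next
    assume "\<forall>j. restrict_keys (multisum B j) (f j) = 0"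
    then show "initial_part f = 0"
      by (simp add: initial_part_def)
  qed
  then show ?thesis
    using iff unfolding a_kernel_def' by (intro Set.set_eqI) (simp only: mem_Collect_eq subring_of_simps, blast)
qed

theorem analytic_spread_eq: "analytic_spread n I = krull_dim T"
proof -
  interpret h: ring_hom_ring Rees T initial_part
    using cring.axioms(1)[OF Rees_cring] cring.axioms(1)[OF T_cring] initial_part_hom
    by (rule ring_hom_ringI2)
  have "fiber_cone R (max_ideal n) I = Rees Quot (a_kernel Rees T initial_part)"
    unfolding fiber_cone_def initial_part_kernel ..
  moreover have "cring (Rees Quot (a_kernel Rees T initial_part))"
    by (rule ideal.quotient_is_cring[OF h.kernel_is_ideal Rees_cring])
  ultimately show ?thesis
    unfolding analytic_spread_def
    using krull_dim_iso[OF _ T_cring h.FactRing_iso_set[OF initial_part_surj]] by simp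
qed

end

section \<open>Counting the lattice points\<close>

text \<open>
A discrete intermediate value theorem.
\<close>

lemma exists_sum_between:
  fixes l u :: "'a \<Rightarrow> nat"
  assumes "finite A" and "\<And>i. i \<in> A \<Longrightarrow> l i \<le> u i" and "sum l A \<le> s" and "s \<le> sum u A"
  shows "\<exists>b. (\<forall>i\<in>A. l i \<le> b i \<and> b i \<le> u i) \<and> sum b A = s"
  using assms
proof (induction A arbitrary: s rule: finite_induct)
  case empty
  then show ?case by auto
next
  case (insert a A)
  define x where "x = max (l a) (s - sum u A)"
  have le: "sum l A \<le> sum u A"
    using insert.prems(1) by (intro sum_mono) auto
  have "l a \<le> x" "x \<le> u a" "sum l A \<le> s - x" "s - x \<le> sum u A" "x \<le> s"
    using insert le by (auto simp: x_def)
  then obtain b where b: "\<forall>i\<in>A. l i \<le> b i \<and> b i \<le> u i" "sum b A = s - x"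
    using insert.IH[of "s - x"] insert.prems(1) by auto
  have "sum (b(a := x)) A = sum b A"
    using insert.hyps by (intro sum.cong) auto
  then show ?case
    using b insert.hyps \<open>l a \<le> x\<close> \<open>x \<le> u a\<close> \<open>x \<le> s\<close>
    by (intro exI[of _ "b(a := x)"]) auto
qed

text \<open>
Lattice points are functions on all natural numbers that vanish outside \<open>{1..n}\<close>, so that points with
equal coordinates are equal.
\<close>

definition box :: "nat \<Rightarrow> nat \<Rightarrow> nat \<Rightarrow> (nat \<Rightarrow> nat) set"
  where "box m n s = {c. (\<forall>i. c i \<le> (if i \<in> {1..n} then m else 0)) \<and> (\<Sum>i = 1..n. c i) = s}"

lemma boxI:
  "(\<And>i. c i \<le> (if i \<in> {1..n} then m else 0)) \<Longrightarrow> sum c {1..n} = s \<Longrightarrow> c \<in> box m n s"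
  unfolding box_def by blast

lemma box_bound: "c \<in> box m n s \<Longrightarrow> c i \<le> (if i \<in> {1..n} then m else 0)"
  unfolding box_def by blast

lemma box_le: "c \<in> box m n s \<Longrightarrow> c i \<le> m"
  using box_bound[of c m n s i] by (cases "i \<in> {1..n}") (simp_all only: if_True if_False le_0_eq zero_le)

lemma box_outside: "c \<in> box m n s \<Longrightarrow> i \<notin> {1..n} \<Longrightarrow> c i = 0"
  using box_bound[of c m n s i] by (simp only: if_False le_0_eq)

lemma box_sum: "c \<in> box m n s \<Longrightarrow> sum c {1..n} = s"
  unfolding box_def by blast

lemma box_0: "box m 0 s = (if s = 0 then {\<lambda>_. 0} else {})"
  by (auto simp: box_def)

lemma box_Suc: "box m (Suc n) s = (\<Union>i\<in>{..min m s}. (\<lambda>c. c(Suc n := i)) ` box m n (s - i))"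
proof (intro equalityI subsetI)
  fix c assume c: "c \<in> box m (Suc n) s"
  have s: "(\<Sum>i = 1..n. c i) + c (Suc n) = s"
    using box_sum[OF c] by simp
  have "(\<Sum>i = 1..n. (c(Suc n := 0)) i) = (\<Sum>i = 1..n. c i)"
    by (intro sum.cong) auto
  moreover have "(c(Suc n := 0)) i \<le> (if i \<in> {1..n} then m else 0)" for i
    using box_le[OF c, of i] box_outside[OF c, of i] by (cases "i = Suc n") auto
  ultimately have c0: "c(Suc n := 0) \<in> box m n (s - c (Suc n))"
    using s by (intro boxI) simp_all
  have "c = (c(Suc n := 0))(Suc n := c (Suc n))"
    by simp
  moreover have "c (Suc n) \<in> {..min m s}"
    using box_le[OF c, of "Suc n"] s by simp
  ultimately show "c \<in> (\<Union>i\<in>{..min m s}. (\<lambda>c. c(Suc n := i)) ` box m n (s - i))"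
    using c0 by (intro UN_I[of "c (Suc n)"] image_eqI[of _ _ "c(Suc n := 0)"])
next
  fix c assume "c \<in> (\<Union>i\<in>{..min m s}. (\<lambda>c. c(Suc n := i)) ` box m n (s - i))"
  then obtain i c' where i: "i \<le> m" "i \<le> s" and c': "c' \<in> box m n (s - i)"
    and c: "c = c'(Suc n := i)"
    by auto
  have "(\<Sum>j = 1..n. c j) = (\<Sum>j = 1..n. c' j)"
    by (intro sum.cong) (auto simp: c)
  then have "(\<Sum>j = 1..Suc n. c j) = s"
    using i box_sum[OF c'] by (simp add: c)
  moreover have "c j \<le> (if j \<in> {1..Suc n} then m else 0)" for j
    using box_le[OF c', of j] box_outside[OF c', of j] i by (cases "j = Suc n") (auto simp: c)
  ultimately show "c \<in> box m (Suc n) s"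
    by (intro boxI)
qed

lemma finite_box: "finite (box m n s)"
  by (induction n arbitrary: s) (auto simp: box_0 box_Suc)

lemma card_box_Suc: "card (box m (Suc n) s) = (\<Sum>i\<le>min m s. card (box m n (s - i)))"
proof -
  have inj: "inj_on (\<lambda>c. c(Suc n := i)) (box m n t)" for i t
  proof (rule inj_onI)
    fix c c' assume c: "c \<in> box m n t" "c' \<in> box m n t" and eq: "c(Suc n := i) = c'(Suc n := i)"
    have "c (Suc n) = 0" "c' (Suc n) = 0"
      using box_outside[OF c(1), of "Suc n"] box_outside[OF c(2), of "Suc n"] by simp_all
    then show "c = c'"
      using eq by (metis fun_upd_triv fun_upd_upd)
  qed
  have "card (box m (Suc n) s) = (\<Sum>i\<le>min m s. card ((\<lambda>c. c(Suc n := i)) ` box m n (s - i)))"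
    unfolding box_Suc
    by (subst card_UN_disjoint) (auto simp: finite_box dest: fun_cong[where x = "Suc n"])
  then show ?thesis
    by (simp add: card_image inj)
qed

lemma card_box_complement:
  assumes "s \<le> m * n"
  shows "card (box m n s) = card (box m n (m * n - s))"
proof -
  define h where "h c = (\<lambda>i. if i \<in> {1..n} then m - c i else (0::nat))" for c :: "nat \<Rightarrow> nat"
  have h: "h c \<in> box m n (m * n - s) \<and> h (h c) = c" if "c \<in> box m n s" for c s
  proof
    note le = box_le[OF that] and z = box_outside[OF that]
    have "sum (h c) {1..n} = (\<Sum>i = 1..n. m - c i)"
      by (intro sum.cong) (auto simp: h_def)
    also have "\<dots> = (\<Sum>i = 1..n. m) - sum c {1..n}"
      using le by (intro sum_subtractf_nat) auto
    finally show "h c \<in> box m n (m * n - s)"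
      using box_sum[OF that] by (intro boxI) (simp_all add: h_def mult.commute)
    show "h (h c) = c"
    proof
      fix i show "h (h c) i = c i"
        using le[of i] z[of i] by (auto simp: h_def)
    qed
  qed
  have dual: "m * n - (m * n - s) = s"
    using assms by simp
  have "bij_betw h (box m n s) (box m n (m * n - s))"
  proof (rule bij_betw_byWitness[where f' = h])
    show "h ` box m n s \<subseteq> box m n (m * n - s)"
      using h by blast
    show "h ` box m n (m * n - s) \<subseteq> box m n s"
      using h[of _ "m * n - s"] unfolding dual by blast
  qed (use h in blast)+
  then show ?thesis
    by (rule bij_betw_same_card)
qed

lemma card_box_sum_0: "card (box m n 0) = 1"
  by (induction n) (simp_all add: box_0 card_box_Suc)

lemma card_box_sum_1: "1 \<le> m \<Longrightarrow> card (box m n 1) = n"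
proof (induction n)
  case (Suc n)
  then have "min m 1 = Suc 0"
    by simp
  with Suc show ?case
    by (simp add: card_box_Suc card_box_sum_0)
qed (simp add: box_0)

lemma card_box_sum_2: "2 \<le> m \<Longrightarrow> card (box m n 2) = (n + 1) choose 2"
proof (induction n)
  case (Suc n)
  have "{..min m 2} = {0, 1, 2}"
    using Suc.prems by auto
  then show ?case
    using Suc card_box_sum_1[of m n]
    by (simp add: card_box_Suc card_box_sum_0 numeral_2_eq_2)
qed (simp add: box_0)

text \<open>
An executable form of the recursion \<open>card_box_Suc\<close>, which settles the cases with $n \leq 3$.
\<close>

fun box_count :: "nat \<Rightarrow> nat \<Rightarrow> nat \<Rightarrow> nat" where
  "box_count m 0 s = (if s = 0 then 1 else 0)"
| "box_count m (Suc n) s = (\<Sum>i\<leftarrow>[0..<Suc (min m s)]. box_count m n (s - i))"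

lemma card_box_eq_box_count: "card (box m n s) = box_count m n s"
proof (induction n arbitrary: s)
  case (Suc n)
  then show ?case
    by (simp add: card_box_Suc interv_sum_list_conv_sum_set_nat atLeast0LessThan lessThan_Suc_atMost
        del: upt_Suc)
qed (simp add: box_0)

lemma small_box_counts:
  "box_count 2 2 2 = 3" "box_count 4 2 4 = 5" "box_count 2 2 3 = 2" "box_count 4 2 6 = 3"
  "box_count 2 3 2 = 6" "box_count 4 3 4 = 15" "box_count 2 3 3 = 7" "box_count 4 3 6 = 19"
  "box_count 2 3 4 = 6" "box_count 4 3 8 = 15" "box_count 2 3 5 = 3" "box_count 4 3 10 = 6"
  by code_simp+

definition level :: "nat \<Rightarrow> (nat \<Rightarrow> nat) \<Rightarrow> nat \<Rightarrow> nat set"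
  where "level n b v = {i \<in> {1..n}. b i = v}"

lemma finite_level [simp]: "finite (level n b v)"
  by (simp add: level_def)

lemma level_subset: "i \<in> level n b v \<Longrightarrow> i \<in> {1..n}"
  by (simp add: level_def)

lemma card_levels:
  assumes "b \<in> box 2 n d"
  shows "card (level n b 0) + card (level n b 1) + card (level n b 2) = n"
    and "card (level n b 1) + 2 * card (level n b 2) = d"
proof -
  have b: "b i = 0 \<or> b i = 1 \<or> b i = 2" for i
    using box_le[OF assms, of i] by linarith
  have U: "{1..n} = level n b 0 \<union> level n b 1 \<union> level n b 2"
  proof (rule Set.set_eqI)
    show "i \<in> {1..n} \<longleftrightarrow> i \<in> level n b 0 \<union> level n b 1 \<union> level n b 2" for i
      using b[of i] by (auto simp: level_def)
  qed
  have disj: "level n b 0 \<inter> level n b 1 = {}" "(level n b 0 \<union> level n b 1) \<inter> level n b 2 = {}"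
    by (auto simp: level_def)
  have "card {1..n} = card (level n b 0) + card (level n b 1) + card (level n b 2)"
    unfolding U using disj by (subst card_Un_disjoint; simp)+
  then show "card (level n b 0) + card (level n b 1) + card (level n b 2) = n"
    by simp
  have "sum b {1..n} = sum b (level n b 0) + sum b (level n b 1) + sum b (level n b 2)"
    unfolding U using disj by (subst sum.union_disjoint; simp)+
  also have "\<dots> = (\<Sum>i\<in>level n b 0. 0) + (\<Sum>i\<in>level n b 1. 1) + (\<Sum>i\<in>level n b 2. 2)"
    by (intro arg_cong2[of _ _ _ _ "(+)"] sum.cong) (auto simp: level_def)
  finally show "card (level n b 1) + 2 * card (level n b 2) = d"
    using assms by (simp add: box_def)
qed

text \<open>
The pairs for which $b + e_i - e_j$ stays in the cube $[0,2]^n$. They are the oriented edges at \<open>b\<close> in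
the graph on \<open>box 2 n d\<close> that joins points differing by a vector $e_i - e_j$.
\<close>

definition moves :: "nat \<Rightarrow> (nat \<Rightarrow> nat) \<Rightarrow> (nat \<times> nat) set"
  where "moves n b = {(i, j). i \<in> {1..n} \<and> j \<in> {1..n} \<and> i \<noteq> j \<and> b i \<le> 1 \<and> 1 \<le> b j}"

text \<open>
With \<open>z\<close> zeros, \<open>o\<close> ones and \<open>t\<close> twos there are $z+o$ choices of \<open>i\<close> and $o+t$ choices of \<open>j\<close>, of which
\<open>o\<close> pairs have $i = j$. Since $z + o + t = n$, the difference $(z+o)(o+t) - o$ equals $(n-1)o + zt$.
\<close>

lemma card_moves:
  assumes "b \<in> box 2 n d"
  shows "int (card (moves n b)) =
    (int n - 1) * int (card (level n b 1)) + int (card (level n b 0)) * int (card (level n b 2))"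
proof -
  let ?Z = "level n b 0" and ?O = "level n b 1" and ?T = "level n b 2"
  have b: "b i = 0 \<or> b i = 1 \<or> b i = 2" for i
    using box_le[OF assms, of i] by linarith
  have eq: "moves n b = (?Z \<union> ?O) \<times> (?O \<union> ?T) - (\<lambda>i. (i, i)) ` ?O"
  proof (rule Set.set_eqI, clarify)
    fix i j
    show "(i, j) \<in> moves n b \<longleftrightarrow> (i, j) \<in> (?Z \<union> ?O) \<times> (?O \<union> ?T) - (\<lambda>i. (i, i)) ` ?O"
      using b[of i] b[of j] by (auto simp: moves_def level_def)
  qed
  have "card (moves n b) = card ((?Z \<union> ?O) \<times> (?O \<union> ?T)) - card ((\<lambda>i. (i, i)) ` ?O)"
    unfolding eq by (intro card_Diff_subset) auto
  moreover have "card ((\<lambda>i. (i, i)) ` ?O) \<le> card ((?Z \<union> ?O) \<times> (?O \<union> ?T))"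
    by (intro card_mono) auto
  moreover have "card ((\<lambda>i. (i, i)) ` ?O) = card ?O"
    by (intro card_image) (auto simp: inj_on_def)
  moreover have "?Z \<inter> ?O = {}" "?O \<inter> ?T = {}"
    by (auto simp: level_def)
  ultimately have "int (card (moves n b)) =
      (int (card ?Z) + int (card ?O)) * (int (card ?O) + int (card ?T)) - int (card ?O)"
    by (simp add: card_cartesian_product card_Un_disjoint of_nat_diff)
  moreover have "int n = int (card ?Z) + int (card ?O) + int (card ?T)"
    using card_levels(1)[OF assms] by simp
  ultimately show ?thesis
    by (simp add: algebra_simps)
qed

definition odd_box :: "nat \<Rightarrow> nat \<Rightarrow> nat \<Rightarrow> (nat \<Rightarrow> nat) set"
  where "odd_box k n d = {c \<in> box 4 n (2 * d). card {i. odd (c i)} = k}"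

lemma finite_odd_box: "finite (odd_box k n d)"
  by (simp add: odd_box_def finite_box)

lemma card_odd_box_0: "card (box 2 n d) \<le> card (odd_box 0 n d)"
proof -
  have "(\<lambda>i. 2 * b i) \<in> odd_box 0 n d" if "b \<in> box 2 n d" for b
  proof -
    have "2 * b i \<le> (if i \<in> {1..n} then 4 else 0)" for i
      using box_le[OF that, of i] box_outside[OF that, of i] by auto
    moreover have "(\<Sum>i = 1..n. 2 * b i) = 2 * d"
      using box_sum[OF that] by (simp flip: sum_distrib_left)
    ultimately show ?thesis
      by (simp add: odd_box_def boxI)
  qed
  then have "(\<lambda>b i. 2 * b i) ` box 2 n d \<subseteq> odd_box 0 n d"
    by blast
  moreover have "inj_on (\<lambda>b i. 2 * b i :: nat) (box 2 n d)"
    by (rule inj_onI) (simp add: fun_eq_iff)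
  ultimately show ?thesis
    using card_inj_on_le finite_odd_box by blast
qed

text \<open>
The sum of the end points \<open>b\<close> and $b + e_i - e_j$ of an edge is $2b + e_i - e_j$. Its odd coordinates
are \<open>i\<close> and \<open>j\<close>, so it determines the oriented edge once it is known whether $i < j$. The edges with
$i < j$ and the edges with $j < i$ therefore both inject into \<open>odd_box 2 n d\<close>, which explains the
factor 2.
\<close>

lemma card_odd_box_2: "(\<Sum>b\<in>box 2 n d. card (moves n b)) \<le> 2 * card (odd_box 2 n d)"
proof -
  define mid :: "(nat \<Rightarrow> nat) \<times> nat \<times> nat \<Rightarrow> nat \<Rightarrow> nat"
    where "mid = (\<lambda>(b, i, j) k. 2 * b k + (if k = i then 1 else 0) - (if k = j then 1 else 0 :: nat))"
  define up where "up = (SIGMA b:box 2 n d. moves n b \<inter> {p. fst p < snd p})"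
  define down where "down = (SIGMA b:box 2 n d. moves n b \<inter> {p. snd p < fst p})"
  have fin: "finite (moves n b)" for b
    by (rule finite_subset[of _ "{1..n} \<times> {1..n}"]) (auto simp: moves_def)
  have mid: "mid (b, i, j) \<in> odd_box 2 n d \<and> {k. odd (mid (b, i, j) k)} = {i, j}
      \<and> (\<forall>k. 2 * b k + (if k = i then 1 else 0) = mid (b, i, j) k + (if k = j then 1 else 0))"
    if b: "b \<in> box 2 n d" and ij: "(i, j) \<in> moves n b" for b i j
  proof -
    have ij: "i \<in> {1..n}" "j \<in> {1..n}" "i \<noteq> j" "b i \<le> 1" "1 \<le> b j"
      using ij by (auto simp: moves_def)
    let ?m = "mid (b, i, j)"
    have eq: "2 * b k + (if k = i then 1 else 0) = ?m k + (if k = j then 1 else 0)" for k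
      using ij by (auto simp: mid_def)
    have "(\<Sum>k = 1..n. 2 * b k + (if k = i then 1 else 0)) = (\<Sum>k = 1..n. ?m k + (if k = j then 1 else 0))"
      by (intro sum.cong eq refl)
    then have "2 * sum b {1..n} + 1 = sum ?m {1..n} + 1"
      using ij by (simp add: sum.distrib sum.delta flip: sum_distrib_left)
    then have "sum ?m {1..n} = 2 * d"
      using b by (simp add: box_def)
    moreover have "?m k \<le> (if k \<in> {1..n} then 4 else 0)" for k
    proof -
      show ?thesis
        using ij box_le[OF b, of k] box_outside[OF b, of k] by (cases "k \<in> {1..n}") (auto simp: mid_def)
    qed
    ultimately have box: "?m \<in> box 4 n (2 * d)"
      unfolding box_def by blast
    have "odd (?m k) \<longleftrightarrow> k \<in> {i, j}" for k
      using arg_cong[OF eq[of k], of even] ij(3) by (auto split: if_splits)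
    then have "{k. odd (?m k)} = {i, j}"
      by blast
    then show ?thesis
      using box ij(3) eq by (simp add: odd_box_def)
  qed
  have inj: "inj_on mid Y" if Y: "Y = up \<or> Y = down" for Y
  proof (rule inj_onI)
    fix p p' assume pY: "p \<in> Y" "p' \<in> Y" and pe: "mid p = mid p'"
    obtain b i j b' i' j' where p: "p = (b, i, j)" "p' = (b', i', j')"
      by (metis prod_cases3)
    have m: "(b, i, j) \<in> Y" "(b', i', j') \<in> Y" and eq: "mid (b, i, j) = mid (b', i', j')"
      using pY pe by (simp_all only: p)
    have m1: "b \<in> box 2 n d" "(i, j) \<in> moves n b" "b' \<in> box 2 n d" "(i', j') \<in> moves n b'"
      using m Y by (auto simp: up_def down_def)
    have "{i, j} = {i', j'}"
      using mid[OF m1(1,2)] mid[OF m1(3,4)] eq by simp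
    moreover have "(i < j \<longleftrightarrow> i' < j') \<and> i \<noteq> j \<and> i' \<noteq> j'"
      using m Y by (auto simp: up_def down_def)
    ultimately have ij: "i = i' \<and> j = j'"
      by (auto simp: doubleton_eq_iff)
    have "b k = b' k" for k
      using mid[OF m1(1,2)] mid[OF m1(3,4)] ij eq
      by (metis add_right_cancel nat_mult_eq_cancel1 zero_less_numeral)
    then show "p = p'"
      using ij by (auto simp: p)
  qed
  have img: "mid ` up \<subseteq> odd_box 2 n d" "mid ` down \<subseteq> odd_box 2 n d"
    using mid by (auto simp: up_def down_def)
  have "card up \<le> card (odd_box 2 n d)"
    using inj[of up] img(1) finite_odd_box card_inj_on_le by blast
  moreover have "card down \<le> card (odd_box 2 n d)"
    using inj[of down] img(2) finite_odd_box card_inj_on_le by blast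
  moreover have "card (moves n b) = card (moves n b \<inter> {p. fst p < snd p}) + card (moves n b \<inter> {p. snd p < fst p})" for b
  proof -
    let ?A = "moves n b \<inter> {p. fst p < snd p}" and ?B = "moves n b \<inter> {p. snd p < fst p}"
    have eq: "moves n b = ?A \<union> ?B"
      by (auto simp: moves_def)
    have "card (?A \<union> ?B) = card ?A + card ?B"
    proof (rule card_Un_disjoint)
      show "finite ?A" "finite ?B"
        by (rule finite_subset[OF _ fin[of b]], rule Int_lower1)+
    qed auto
    then show ?thesis
      by (rule trans[OF arg_cong[OF eq, of card]])
  qed
  then have "(\<Sum>b\<in>box 2 n d. card (moves n b)) = (\<Sum>b\<in>box 2 n d.
      card (moves n b \<inter> {p. fst p < snd p}) + card (moves n b \<inter> {p. snd p < fst p}))"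
    by (rule sum.cong[OF refl])
  moreover have "card up = (\<Sum>b\<in>box 2 n d. card (moves n b \<inter> {p. fst p < snd p}))"
    unfolding up_def by (rule card_SigmaI) (use fin finite_box in blast)+
  moreover have "card down = (\<Sum>b\<in>box 2 n d. card (moves n b \<inter> {p. snd p < fst p}))"
    unfolding down_def by (rule card_SigmaI) (use fin finite_box in blast)+
  ultimately show ?thesis
    unfolding sum.distrib by linarith
qed

text \<open>
Take $2b + (1,1,1,1,0,\ldots,0)$ with a point \<open>b\<close> of sum $d-2$ whose first four coordinates are at
most 1; such a point exists because $d - 2 \leq 4 + 2(n-4)$.
\<close>

lemma odd_box_4_nonempty:
  assumes "4 \<le> n" "2 \<le> d" "d \<le> 2 * n - 2"
  shows "odd_box 4 n d \<noteq> {}"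
proof -
  define u where "u i = (if i \<le> 4 then 1 else 2 :: nat)" for i :: nat
  have "{1..n} = {1..4} \<union> {5..n}"
    using assms by auto
  then have split: "sum f {1..n} = sum f {1..4} + sum f {5..n}" for f :: "nat \<Rightarrow> nat"
    by (simp add: sum.union_disjoint)
  have "sum u {5..n} = (\<Sum>i = 5..n. 2)"
    by (intro sum.cong) (auto simp: u_def)
  moreover have "sum u {1..4} = 4"
    by (simp add: u_def)
  ultimately have "d - 2 \<le> sum u {1..n}"
    using assms unfolding split by simp
  then obtain b where "\<forall>i\<in>{1..n}. 0 \<le> b i \<and> b i \<le> u i" and b2: "sum b {1..n} = d - 2"
    using exists_sum_between[of "{1..n}" "\<lambda>_. 0" u "d - 2"] by force
  then have b1: "b i \<le> u i" if "i \<in> {1..n}" for i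
    using that by blast
  define c where "c i = (if i \<in> {1..n} then 2 * b i + (if i \<le> 4 then 1 else 0) else 0)" for i
  have "c i \<le> (if i \<in> {1..n} then 4 else 0)" for i
    using b1[of i] by (auto simp: c_def u_def)
  moreover have "sum c {1..n} = 2 * d"
  proof -
    have "sum c {1..n} = (\<Sum>i = 1..n. 2 * b i) + (\<Sum>i = 1..n. if i \<le> 4 then 1 else 0)"
      unfolding sum.distrib[symmetric] by (intro sum.cong) (auto simp: c_def)
    also have "(\<Sum>i = 1..n. if i \<le> 4 then 1 else 0) = (4::nat)"
    proof -
      have "(\<Sum>i = 5..n. if i \<le> 4 then 1 else 0) = (0::nat)"
        by (intro sum.neutral) auto
      then show ?thesis
        unfolding split by simp
    qed
    finally show ?thesis
      using b2 assms by (simp flip: sum_distrib_left)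
  qed
  moreover have "{i. odd (c i)} = {1..4}"
    using assms by (auto simp: c_def)
  ultimately have "c \<in> odd_box 4 n d"
    using boxI[of c n 4] by (simp add: odd_box_def)
  then show ?thesis
    by blast
qed

text \<open>
A point is determined by the positions of its ones and twos. If it has at most one 1, it has exactly
\<open>d div 2\<close> twos.
\<close>

lemma card_level_profile:
  "card {b \<in> box 2 n d. card (level n b 1) = 0} \<le> n choose (d div 2)"
  "card {b \<in> box 2 n d. card (level n b 1) = 1} \<le> n * ((n - 1) choose (d div 2))"
proof -
  let ?A = "\<lambda>k. {b \<in> box 2 n d. card (level n b 1) = k}"
  have inj: "inj_on (\<lambda>b. (level n b 1, level n b 2)) (box 2 n d)"
  proof (rule inj_onI)
    fix b b' assume bb: "b \<in> box 2 n d" "b' \<in> box 2 n d"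
      and eq: "(level n b 1, level n b 2) = (level n b' 1, level n b' 2)"
    show "b = b'"
    proof
      fix i
      show "b i = b' i"
      proof (cases "i \<in> {1..n}")
        case True
        have "b i = 1 \<longleftrightarrow> b' i = 1" "b i = 2 \<longleftrightarrow> b' i = 2"
          using eq True by (auto simp: level_def)
        moreover have "b i \<le> 2" "b' i \<le> 2"
          using bb box_le by auto
        ultimately show ?thesis
          by linarith
      qed (use box_outside[OF bb(1)] box_outside[OF bb(2)] in simp)
    qed
  qed
  have T: "card (level n b 2) = d div 2" if "b \<in> box 2 n d" "card (level n b 1) < 2" for b
    using card_levels(2)[OF that(1)] that(2) by auto
  have "inj_on (\<lambda>b. level n b 2) (?A 0)"
  proof (rule inj_onI)
    fix b b' assume "b \<in> ?A 0" "b' \<in> ?A 0" "level n b 2 = level n b' 2"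
    then show "b = b'"
      using inj by (auto simp: inj_on_def)
  qed
  moreover have "(\<lambda>b. level n b 2) ` ?A 0 \<subseteq> {Y. Y \<subseteq> {1..n} \<and> card Y = d div 2}"
    using T level_subset by fastforce
  ultimately have "card (?A 0) \<le> card {Y. Y \<subseteq> {1..n} \<and> card Y = d div 2}"
    by (intro card_inj_on_le) auto
  then show "card (?A 0) \<le> n choose (d div 2)"
    by (simp add: n_subsets)
  let ?S = "SIGMA i:{1..n}. {Y. Y \<subseteq> {1..n} - {i} \<and> card Y = d div 2}"
  have "inj_on (\<lambda>b. (the_elem (level n b 1), level n b 2)) (?A 1)"
  proof (rule inj_onI)
    fix b b' assume b: "b \<in> ?A 1" "b' \<in> ?A 1"
      and eq: "(the_elem (level n b 1), level n b 2) = (the_elem (level n b' 1), level n b' 2)"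
    have "level n b 1 = level n b' 1"
      using b eq by (auto simp: card_1_singleton_iff)
    then show "b = b'"
      using b eq inj by (auto simp: inj_on_def)
  qed
  moreover have "(\<lambda>b. (the_elem (level n b 1), level n b 2)) ` ?A 1 \<subseteq> ?S"
  proof
    fix x assume "x \<in> (\<lambda>b. (the_elem (level n b 1), level n b 2)) ` ?A 1"
    then obtain b where b: "b \<in> box 2 n d" "card (level n b 1) = 1"
      and x: "x = (the_elem (level n b 1), level n b 2)"
      by auto
    obtain i where i: "level n b 1 = {i}"
      using b(2) by (auto simp: card_1_singleton_iff)
    then have "i \<in> level n b 1"
      by blast
    then have "i \<in> {1..n}" "level n b 2 \<subseteq> {1..n} - {i}"
      unfolding level_def by auto
    moreover have "card (level n b 2) = d div 2"
      using T[OF b(1)] b(2) by simp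
    ultimately show "x \<in> ?S"
      unfolding x i by simp
  qed
  moreover have "finite {Y. Y \<subseteq> {1..n} - {i} \<and> card Y = d div 2}" for i
    by (rule finite_subset[of _ "Pow {1..n}"]) auto
  then have "finite ?S"
    by (intro finite_SigmaI) auto
  ultimately have "card (?A 1) \<le> card ?S"
    by (rule card_inj_on_le)
  then show "card (?A 1) \<le> n * ((n - 1) choose (d div 2))"
    by (simp add: card_SigmaI n_subsets)
qed

lemma sum_ge_if_few_negative:
  fixes f :: "'a \<Rightarrow> int"
  assumes fin: "finite A" and "\<And>x. x \<in> A \<Longrightarrow> Q x \<Longrightarrow> w \<le> f x" and "\<And>x. x \<in> A \<Longrightarrow> \<not> Q x \<Longrightarrow> 0 \<le> f x"
    and "card {x \<in> A. Q x} \<le> N" and "M \<le> 0" and "w < 0 \<Longrightarrow> M \<le> int N * w"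
  shows "M \<le> sum f A"
proof -
  have "M \<le> int (card {x \<in> A. Q x}) * w"
  proof (cases "w < 0")
    case True
    then have "int N * w \<le> int (card {x \<in> A. Q x}) * w"
      using assms(4) by (intro mult_right_mono_neg) auto
    then show ?thesis using assms(6) True by linarith
  next
    case False
    then have "0 \<le> int (card {x \<in> A. Q x}) * w" by simp
    then show ?thesis using assms(5) by linarith
  qed
  moreover have "int (card {x \<in> A. Q x}) * w = (\<Sum>x\<in>A. if Q x then w else 0)"
    using fin by (simp add: sum.If_cases Int_def)
  moreover have "(\<Sum>x\<in>A. if Q x then w else 0) \<le> sum f A"
    using assms(2,3) by (intro sum_mono) auto
  ultimately show ?thesis
    by linarith
qed

lemma int_choose_two: "int (n choose 2) * 2 = int n * (int n - 1)"
proof (cases n)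
  case (Suc k)
  have "(n choose 2) * 2 = n * (n - 1)"
    unfolding choose_two by (intro dvd_div_mult_self) (simp add: Suc)
  then have "int ((n choose 2) * 2) = int (n * (n - 1))"
    by simp
  then show ?thesis
    by (simp add: Suc algebra_simps)
qed simp

text \<open>
The left-hand side is the degree sum of a graph in which every vertex has degree $2(n-1)$, lowered
by $n(n-1)$. A point with at least two ones has degree at least $2(n-1)$, so only points with
fewer ones matter; \<open>wt\<close> is the excess of the degree over $2(n-1)$.

If \<open>d\<close> is even, these points have $t = d/2$ twos, $z = n-t$ zeros and no ones. There are \<open>n choose t\<close>
of them, each with excess $tz - 2(n-1) = (t-2)(z-2) - 2$. This is negative only if \<open>t\<close> or \<open>z\<close> is 1 or 2
or if $t = z = 3$, and the bound is attained for 1 and 2.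

If \<open>d\<close> is odd, they have one 1, $t = (d-1)/2$ twos and $z = n-1-t$ zeros. There are at most
\<open>n * (n - 1 choose t)\<close> of them, each with excess $tz - (n-1) = (t-1)(z-1) - 1$, which is negative only
if \<open>t\<close> or \<open>z\<close> is 1.
\<close>

lemma sum_moves_ge:
  assumes n: "2 \<le> n" and d: "2 \<le> d" "d \<le> 2 * n - 2"
  shows "2 * (int n - 1) * int (card (box 2 n d)) - int n * (int n - 1)
    \<le> int (\<Sum>b\<in>box 2 n d. card (moves n b))"
proof -
  define t where "t = d div 2"
  define wt where "wt b = int (card (moves n b)) - 2 * (int n - 1)" for b
  have "- (int n * (int n - 1)) \<le> sum wt (box 2 n d)"
  proof (cases "even d")
    case True
    then have td: "d = 2 * t" "1 \<le> t" "t \<le> n - 1"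
      using d by (auto simp: t_def)
    define w where "w = (int t - 2) * (int (n - t) - 2) - 2"
    show ?thesis
    proof (rule sum_ge_if_few_negative[where Q = "\<lambda>b. card (level n b 1) = 0" and w = w])
      fix b assume b: "b \<in> box 2 n d" "card (level n b 1) = 0"
      then have "card (level n b 2) = t" "card (level n b 0) = n - t"
        using card_levels[OF b(1)] td by auto
      then show "w \<le> wt b"
        using card_moves[OF b(1)] b(2) td by (simp add: wt_def w_def algebra_simps of_nat_diff)
    next
      fix b assume b: "b \<in> box 2 n d" "card (level n b 1) \<noteq> 0"
      then have "2 \<le> card (level n b 1)"
        using card_levels(2)[OF b(1)] True by presburger
      then have "(int n - 1) * 2 \<le> (int n - 1) * int (card (level n b 1))"
        using n by (intro mult_left_mono) auto
      then show "0 \<le> wt b"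
        using card_moves[OF b(1)] zero_le_mult_iff[of "int (card (level n b 0))" "int (card (level n b 2))"]
        unfolding wt_def by linarith
    next
      show "card {b \<in> box 2 n d. card (level n b 1) = 0} \<le> n choose t"
        using card_level_profile(1) by (simp add: t_def)
    next
      assume neg: "w < 0"
      define z where "z = n - t"
      have nz: "n = t + z" "1 \<le> z"
        using td n by (auto simp: z_def)
      have sym: "n choose t = n choose z"
        using nz binomial_symmetric[of t n] by simp
      consider "t = 1" | "z = 1" | "t = 2" | "z = 2" | "3 \<le> t" "3 \<le> z"
        using td(2) nz(2) by linarith
      then show "- (int n * (int n - 1)) \<le> int (n choose t) * w"
      proof cases
        case 1
        then show ?thesis using nz by (simp add: w_def algebra_simps)
      next
        case 2
        then show ?thesis using nz sym by (simp add: w_def algebra_simps)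
      next
        case 3
        have "int (n choose 2) * 2 = int n * (int n - 1)"
          by (rule int_choose_two)
        then show ?thesis using 3 nz by (simp add: w_def algebra_simps)
      next
        case 4
        have "int (n choose 2) * 2 = int n * (int n - 1)"
          by (rule int_choose_two)
        then show ?thesis using 4 nz sym by (simp add: w_def algebra_simps)
      next
        case 5
        have "t = 3 \<and> z = 3"
        proof (rule ccontr)
          assume "\<not> ?thesis"
          then have "1 * 2 \<le> (int t - 2) * (int z - 2) \<or> 2 * 1 \<le> (int t - 2) * (int z - 2)"
            using 5 mult_mono[of 1 "int t - 2" 2 "int z - 2"] mult_mono[of 2 "int t - 2" 1 "int z - 2"]
            by (cases "t = 3") auto
          then show False using neg nz by (simp add: w_def)
        qed
        moreover have "(6::nat) choose 3 = 20" by code_simp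
        ultimately show ?thesis using nz by (simp add: w_def)
      qed
    qed (use n in \<open>auto simp: finite_box\<close>)
  next
    case False
    then have td: "d = 2 * t + 1" "1 \<le> t" "t \<le> n - 2"
      using d by (auto simp: t_def elim!: oddE)
    define z where "z = n - 1 - t"
    have nz: "n = t + z + 1" "1 \<le> z"
      using td n by (auto simp: z_def)
    define w where "w = (int t - 1) * (int z - 1) - 1"
    show ?thesis
    proof (rule sum_ge_if_few_negative[where Q = "\<lambda>b. card (level n b 1) = 1" and w = w])
      fix b assume b: "b \<in> box 2 n d" "card (level n b 1) = 1"
      then have "card (level n b 2) = t" "card (level n b 0) = z"
        using card_levels[OF b(1)] td by (auto simp: z_def)
      then show "w \<le> wt b"
        using card_moves[OF b(1)] b(2) nz by (simp add: wt_def w_def algebra_simps)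
    next
      fix b assume b: "b \<in> box 2 n d" "card (level n b 1) \<noteq> 1"
      then have "2 \<le> card (level n b 1)"
        using card_levels(2)[OF b(1)] False by presburger
      then have "(int n - 1) * 2 \<le> (int n - 1) * int (card (level n b 1))"
        using n by (intro mult_left_mono) auto
      then show "0 \<le> wt b"
        using card_moves[OF b(1)] zero_le_mult_iff[of "int (card (level n b 0))" "int (card (level n b 2))"]
        unfolding wt_def by linarith
    next
      show "card {b \<in> box 2 n d. card (level n b 1) = 1} \<le> n * ((n - 1) choose t)"
        using card_level_profile(2) by (simp add: t_def)
    next
      assume neg: "w < 0"
      have sym: "(n - 1) choose t = (n - 1) choose z"
        using nz binomial_symmetric[of t "n - 1"] by simp
      consider "t = 1" | "z = 1" | "2 \<le> t" "2 \<le> z"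
        using td(2) nz(2) by linarith
      then show "- (int n * (int n - 1)) \<le> int (n * ((n - 1) choose t)) * w"
      proof cases
        case 1
        then show ?thesis using nz by (simp add: w_def algebra_simps)
      next
        case 2
        then show ?thesis using nz sym by (simp add: w_def algebra_simps)
      next
        case 3
        then have "1 * 1 \<le> (int t - 1) * (int z - 1)"
          by (intro mult_mono) auto
        then show ?thesis using neg by (simp add: w_def)
      qed
    qed (use n in \<open>auto simp: finite_box\<close>)
  qed
  then show ?thesis
    by (simp add: wt_def sum_subtractf algebra_simps)
qed

lemma card_box_4_gt:
  assumes n: "4 \<le> n" and d: "2 \<le> d" "d \<le> 2 * n - 2"
  shows "int n * int (card (box 2 n d)) - int (n choose 2) < int (card (box 4 n (2 * d)))"
proof -
  have sub: "odd_box 0 n d \<union> odd_box 2 n d \<union> odd_box 4 n d \<subseteq> box 4 n (2 * d)"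
    by (auto simp: odd_box_def)
  have "card (odd_box 0 n d \<union> odd_box 2 n d \<union> odd_box 4 n d)
      = card (odd_box 0 n d) + card (odd_box 2 n d) + card (odd_box 4 n d)"
    by (subst card_Un_disjoint; (subst card_Un_disjoint)?) (auto simp: finite_odd_box, auto simp: odd_box_def)
  then have "card (odd_box 0 n d) + card (odd_box 2 n d) + card (odd_box 4 n d) \<le> card (box 4 n (2 * d))"
    using card_mono[OF finite_box sub] by simp
  moreover have "1 \<le> card (odd_box 4 n d)"
    using odd_box_4_nonempty[OF assms] by (simp add: Suc_leI card_gt_0_iff finite_odd_box)
  moreover have "2 * (int n - 1) * int (card (box 2 n d)) - int n * (int n - 1) \<le> 2 * int (card (odd_box 2 n d))"
    using sum_moves_ge[of n d] card_odd_box_2[of n d] n d by linarith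
  moreover have "int (n choose 2) * 2 = int n * (int n - 1)"
    by (rule int_choose_two)
  ultimately show ?thesis
    using card_odd_box_0[of n d] by (simp add: algebra_simps)
qed

section \<open>Veronese type ideals with bound 2\<close>

definition veronese_exponents :: "nat \<Rightarrow> nat \<Rightarrow> nat \<Rightarrow> (nat \<Rightarrow>\<^sub>0 nat) set"
  where "veronese_exponents k n d = {b \<in> exponents n d. \<forall>i\<in>{1..n}. lookup b i \<le> k}"

definition expo_of :: "nat \<Rightarrow> (nat \<Rightarrow> nat) \<Rightarrow> nat \<Rightarrow>\<^sub>0 nat"
  where "expo_of n f = (\<Sum>i = 1..n. single i (f i))"

lemma lookup_expo_of: "lookup (expo_of n f) i = (if i \<in> {1..n} then f i else 0)"
  by (simp add: expo_of_def lookup_sum lookup_single when_def sum.delta)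

lemma expo_of_in_expo: "expo_of n f \<in> expo n"
  unfolding expo_def mem_Collect_eq by (auto simp: in_keys_iff lookup_expo_of split: if_splits)

lemma tdeg_expo_of: "tdeg n (expo_of n f) = sum f {1..n}"
  unfolding tdeg_def by (intro sum.cong) (auto simp: lookup_expo_of)

lemma veronese_exponents_iff:
  "c \<in> veronese_exponents k n d \<longleftrightarrow> c \<in> expo n \<and> tdeg n c = d \<and> (\<forall>i\<in>{1..n}. lookup c i \<le> k)"
  by (auto simp: veronese_exponents_def exponents_eq)

lemma expo_of_veronese:
  "sum f {1..n} = d \<Longrightarrow> (\<And>i. i \<in> {1..n} \<Longrightarrow> f i \<le> k) \<Longrightarrow> expo_of n f \<in> veronese_exponents k n d"
  by (simp add: veronese_exponents_iff expo_of_in_expo tdeg_expo_of lookup_expo_of)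

lemma card_veronese_exponents: "card (veronese_exponents k n d) = card (box k n d)"
proof (rule bij_betw_same_card[of lookup], rule bij_betw_imageI)
  show "inj_on lookup (veronese_exponents k n d)"
    by (rule inj_onI) simp
  show "lookup ` veronese_exponents k n d = box k n d"
  proof (intro equalityI subsetI)
    fix f assume "f \<in> lookup ` veronese_exponents k n d"
    then obtain c where c: "f = lookup c" "c \<in> veronese_exponents k n d"
      by blast
    show "f \<in> box k n d"
    proof (rule boxI)
      fix i show "f i \<le> (if i \<in> {1..n} then k else 0)"
        using c lookup_outside[of c n i] by (simp add: veronese_exponents_iff)
      show "sum f {1..n} = d"
        using c by (simp add: veronese_exponents_iff tdeg_def)
    qed
  next
    fix f assume f: "f \<in> box k n d"
    have "lookup (expo_of n f) = f"
      using box_outside[OF f] by (auto simp: lookup_expo_of fun_eq_iff)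
    moreover have "expo_of n f \<in> veronese_exponents k n d"
      using box_sum[OF f] box_le[OF f] by (intro expo_of_veronese)
    ultimately show "f \<in> lookup ` veronese_exponents k n d"
      by (metis imageI)
  qed
qed

text \<open>
A splitting $c = f + g$ has both parts in $[0,2]^n$ if and only if \<open>f\<close> lies between
$l = \max(c-2,0)$ and $u = \min(c,2)$. As $l + u = c$ has sum \<open>2d\<close>, the value \<open>d\<close> lies between the sums of
\<open>l\<close> and \<open>u\<close>, so \<open>f\<close> can be chosen with sum \<open>d\<close>.
\<close>

lemma sumset_veronese_2: "sumset (veronese_exponents 2 n d) (veronese_exponents 2 n d) = veronese_exponents 4 n (2 * d)"
proof (intro equalityI subsetI)
  fix c assume "c \<in> sumset (veronese_exponents 2 n d) (veronese_exponents 2 n d)"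
  then obtain a b where c: "c = a + b" "a \<in> veronese_exponents 2 n d" "b \<in> veronese_exponents 2 n d"
    unfolding sumset_def by blast
  have "lookup a i + lookup b i \<le> 4" if "i \<in> {1..n}" for i
    using c(2,3) that add_mono[of "lookup a i" 2 "lookup b i" 2] by (simp add: veronese_exponents_iff)
  then show "c \<in> veronese_exponents 4 n (2 * d)"
    using c submonoid_expo[of n]
    by (simp add: veronese_exponents_iff tdeg_add lookup_add submonoid_set_def)
next
  fix c assume "c \<in> veronese_exponents 4 n (2 * d)"
  then have c: "c \<in> expo n" "tdeg n c = 2 * d" "\<And>i. i \<in> {1..n} \<Longrightarrow> lookup c i \<le> 4"
    by (simp_all add: veronese_exponents_iff)
  define l u where "l i = lookup c i - 2" and "u i = min 2 (lookup c i)" for i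
  have lu: "l i \<le> u i" if "i \<in> {1..n}" for i
    using c(3)[OF that] by (simp add: l_def u_def)
  have "sum l {1..n} + sum u {1..n} = tdeg n c"
    unfolding tdeg_def sum.distrib[symmetric] by (intro sum.cong) (auto simp: l_def u_def)
  moreover have "sum l {1..n} \<le> sum u {1..n}"
    by (intro sum_mono lu)
  ultimately obtain f where f: "\<forall>i\<in>{1..n}. l i \<le> f i \<and> f i \<le> u i" "sum f {1..n} = d"
    using exists_sum_between[of "{1..n}" l u d] lu c(2) by auto
  define g where "g i = lookup c i - f i" for i
  have fg: "f i \<le> 2" "g i \<le> 2" "f i + g i = lookup c i" if "i \<in> {1..n}" for i
    using bspec[OF f(1) that] c(3)[OF that] unfolding l_def u_def g_def by linarith+
  have "sum f {1..n} + sum g {1..n} = tdeg n c"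
    unfolding tdeg_def sum.distrib[symmetric] using fg(3) by (intro sum.cong) auto
  then have "sum g {1..n} = d"
    using f(2) c(2) by simp
  then have mem: "expo_of n f \<in> veronese_exponents 2 n d" "expo_of n g \<in> veronese_exponents 2 n d"
    using f(2) fg(1,2) by (blast intro: expo_of_veronese)+
  have "c = expo_of n f + expo_of n g"
  proof (rule poly_mapping_eqI)
    fix i show "lookup c i = lookup (expo_of n f + expo_of n g) i"
      using fg(3)[of i] lookup_outside[OF c(1), of i] by (simp add: lookup_add lookup_expo_of)
  qed
  then show "c \<in> sumset (veronese_exponents 2 n d) (veronese_exponents 2 n d)"
    unfolding sumset_def using mem by blast
qed

lemma multisum_2: "multisum B 2 = sumset B B"
  by (simp add: numeral_2_eq_2)

lemma veronese_ideal_eq: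
  "veronese_ideal k n d = Idl\<^bsub>mpoly_ring n\<^esub> (monomial ` veronese_exponents k n d)"
  by (simp add: veronese_ideal_def veronese_exponents_def)

lemma min_num_gens_veronese:
  "min_num_gens (mpoly_ring n) (veronese_ideal k n d :: ((nat \<Rightarrow>\<^sub>0 nat) \<Rightarrow>\<^sub>0 'k::field) set) = card (box k n d)"
proof -
  have "veronese_exponents k n d \<subseteq> exponents n d"
    by (auto simp: veronese_exponents_def)
  from min_num_gens_monomials[OF this] show ?thesis
    unfolding veronese_ideal_eq card_veronese_exponents .
qed

lemma square_veronese_ideal:
  "ideal_power (mpoly_ring n) (veronese_ideal 2 n d) 2
    = (veronese_ideal 4 n (2 * d) :: ((nat \<Rightarrow>\<^sub>0 nat) \<Rightarrow>\<^sub>0 'k::field) set)"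
proof -
  have sub: "veronese_exponents k n d \<subseteq> expo n" for k d
    by (auto simp: veronese_exponents_iff)
  show ?thesis
    unfolding veronese_ideal_eq mpoly_ring_eq
    unfolding ideal_power_monomials[OF submonoid_expo sub]
    unfolding genideal_monomials[OF submonoid_expo sub] multisum_2 sumset_veronese_2 ..
qed

text \<open>
The linear form $k |c| - d c_i$ is nonnegative on \<open>B\<close>, hence on the monoid that \<open>B\<close> generates. This makes
the truncated subtraction in the functionals that define the flag of faces exact.
\<close>

lemma generated_veronese_bound:
  assumes "c \<in> generated_monoid (veronese_exponents k n d)"
  shows "d * lookup c i \<le> k * tdeg n c"
proof -
  have "tdeg n c = j * d \<and> lookup c i \<le> j * k" if "c \<in> multisum (veronese_exponents k n d) j" for j
    using that
  proof (induction j arbitrary: c)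
    case (Suc j)
    then obtain a b where c: "c = a + b" "a \<in> multisum (veronese_exponents k n d) j" "b \<in> veronese_exponents k n d"
      by (auto simp: sumset_def)
    have "tdeg n b = d" "lookup b i \<le> k"
      using c(3) lookup_outside[of b n i] by (auto simp: veronese_exponents_iff)
    then show ?case
      using Suc.IH[OF c(2)] by (simp add: c(1) tdeg_add lookup_add)
  qed simp
  then obtain j where "tdeg n c = j * d" "lookup c i \<le> j * k"
    using assms unfolding generated_monoid_def by blast
  then show ?thesis
    using mult_le_mono2[of "lookup c i" "j * k" d] by (simp add: mult_ac)
qed

text \<open>
The functionals \<open>L 0\<close>, \dots, \<open>L (n - 1)\<close> are nonnegative on the cone over \<open>B\<close>. Setting them to zero one
after the other imposes $c_i = 2$ (relative to the degree) for $i = 1, \ldots, q$, then $c_i = 0$ for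
$i = n, \ldots, q+2$, and finally $c = 0$. The faces shrink to the ray through the vertex
$v = (2,\ldots,2,r,0,\ldots,0)$ with \<open>q\<close> twos and $r \in \{1,2\}$, and then to the origin. Moving one unit of
\<open>v\<close> gives a point that satisfies the first \<open>i\<close> conditions and violates the next one:
$v - e_{i+1} + e_n$ in the first phase, $v - e_{q+1} + e_t$ in the second phase, where \<open>t\<close> is the
coordinate to be annihilated, and \<open>v\<close> itself in the last step.
\<close>

lemma exists_vertex_flag:
  fixes n d :: nat
  assumes "0 < d" "d < 2 * n"
  defines "q \<equiv> (d - 1) div 2"
  defines "L \<equiv> \<lambda>k c. if k < q then 2 * tdeg n c - d * lookup c (k + 1)
    else if k < n - 1 then lookup c (n - (k - q)) else tdeg n c"
  assumes "i < n"
  shows "\<exists>w\<in>veronese_exponents 2 n d. (\<forall>k<i. L k w = 0) \<and> L i w \<noteq> 0"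
proof -
  define r where "r = d - 2 * q"
  have q: "q + 1 \<le> n" "d = 2 * q + r" "1 \<le> r" "r \<le> 2" "q + 1 = n \<Longrightarrow> r = 1"
    using assms(1,2) by (auto simp: q_def r_def)
  define v where "v j = (if j \<le> q then 2 else if j = q + 1 then r else 0)" for j
  have sum_v: "sum v {1..n} = d"
  proof -
    have "{1..n} = {1..q} \<union> {q + 1} \<union> {q + 2..n}"
      using q(1) by auto
    then have "sum v {1..n} = sum v {1..q} + sum v {q + 1} + sum v {q + 2..n}"
      by (simp add: sum.union_disjoint)
    moreover have "sum v {1..q} = (\<Sum>j = 1..q. 2)" "sum v {q + 2..n} = (\<Sum>j = q + 2..n. 0)"
      by (rule sum.cong; simp add: v_def)+
    ultimately show ?thesis
      using q(2) by (simp add: v_def)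
  qed
  define w where "w a b j = (if j = a then v j - 1 else if j = b then v j + 1 else v j)" for a b j
  have w_mem: "expo_of n (w a b) \<in> veronese_exponents 2 n d"
    if "a \<in> {1..n}" "b \<in> {1..n}" "a \<noteq> b" "1 \<le> v a" "v b \<le> 1" for a b
  proof (rule expo_of_veronese)
    show "w a b j \<le> 2" for j
      using that q by (auto simp: w_def v_def)
    have "(\<Sum>j = 1..n. w a b j + (if j = a then 1 else 0)) = (\<Sum>j = 1..n. v j + (if j = b then 1 else 0))"
      using that by (intro sum.cong) (auto simp: w_def)
    then show "sum (w a b) {1..n} = d"
      using that sum_v by (simp add: sum.distrib sum.delta)
  qed
  consider "i < q" | "q \<le> i" "i < n - 1" | "i = n - 1"
    using \<open>i < n\<close> by linarith
  then show ?thesis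
  proof cases
    case 1
    \<comment> \<open>If \<open>n = q + 1\<close>, this is \<open>r = 1\<close>, which holds because \<open>d < 2 * n\<close>.\<close>
    have "v n \<le> 1"
      using q by (auto simp: v_def)
    then have mem: "expo_of n (w (i + 1) n) \<in> veronese_exponents 2 n d"
      using 1 q by (intro w_mem) (auto simp: v_def)
    then have "tdeg n (expo_of n (w (i + 1) n)) = d"
      by (simp add: veronese_exponents_iff)
    then show ?thesis
      using 1 q(1) \<open>0 < d\<close>
      by (intro bexI[OF _ mem]) (auto simp: L_def lookup_expo_of w_def v_def)
  next
    case 2
    define t where "t = n - (i - q)"
    have t: "q + 2 \<le> t" "t \<le> n"
      using 2 by (auto simp: t_def)
    then have mem: "expo_of n (w (q + 1) t) \<in> veronese_exponents 2 n d"
      using q by (intro w_mem) (auto simp: v_def)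
    let ?w = "expo_of n (w (q + 1) t)"
    have deg: "tdeg n ?w = d"
      using mem by (simp add: veronese_exponents_iff)
    have twos: "lookup ?w j = 2" if "j \<in> {1..q}" for j
      using that t q(1) by (simp add: lookup_expo_of w_def v_def)
    have zeros: "lookup ?w j = 0" if "t < j" for j
      using that t by (simp add: lookup_expo_of w_def v_def)
    have "L k ?w = 0" if "k < i" for k
    proof (cases "k < q")
      case True
      then show ?thesis
        using twos[of "k + 1"] deg by (simp add: L_def)
    next
      case False
      then have "t < n - (k - q)"
        using that 2 by (simp add: t_def)
      then show ?thesis
        using zeros False that 2 by (simp add: L_def)
    qed
    moreover have "lookup ?w t = 1"
      using t by (simp add: lookup_expo_of w_def v_def)
    then have "L i ?w \<noteq> 0"
      using 2 by (simp add: L_def t_def)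
    ultimately show ?thesis
      using mem by blast
  next
    case 3
    have mem: "expo_of n v \<in> veronese_exponents 2 n d"
      using q sum_v by (intro expo_of_veronese) (auto simp: v_def)
    then have "tdeg n (expo_of n v) = d"
      by (simp add: veronese_exponents_iff)
    moreover have "q + 2 \<le> n - (k - q)" if "q \<le> k" "k < n - 1" for k
      using that by auto
    ultimately show ?thesis
      using 3 q(1) \<open>0 < d\<close>
      by (intro bexI[OF _ mem] conjI allI impI) (fastforce simp: L_def lookup_expo_of v_def)+
  qed
qed

theorem analytic_spread_veronese:
  assumes "0 < d" "d < 2 * n"
  shows "analytic_spread n (veronese_ideal 2 n d :: ((nat \<Rightarrow>\<^sub>0 nat) \<Rightarrow>\<^sub>0 'k::field) set) = enat n"
proof -
  define B where "B = veronese_exponents 2 n d"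
  define M where "M = generated_monoid B"
  have B_sub: "B \<subseteq> exponents n d"
    by (auto simp: B_def veronese_exponents_def)
  interpret equigenerated n d B "TYPE('k)"
    by unfold_locales (fact B_sub assms)+
  have M: "submonoid_set M" "M \<subseteq> expo n"
    unfolding M_def using submonoid_generated generated_monoid_subset[OF submonoid_expo B_expo] by auto
  have BM: "B \<subseteq> M"
  proof
    fix b assume "b \<in> B"
    then have "b \<in> multisum B (Suc 0)"
      by simp
    then show "b \<in> M"
      unfolding M_def generated_monoid_def by blast
  qed
  define q where "q = (d - 1) div 2"
  define L where "L k c = (if k < q then 2 * tdeg n c - d * lookup c (k + 1)
    else if k < n - 1 then lookup c (n - (k - q)) else tdeg n c)" for k c
  define F where "F i = {c \<in> M. \<forall>k<i. L k c = 0}" for i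
  have L_add: "L k (a + b) = L k a + L k b" if "a \<in> M" "b \<in> M" for k a b
    using generated_veronese_bound[of a 2 n d "k + 1"] generated_veronese_bound[of b 2 n d "k + 1"] that
    by (simp add: L_def M_def B_def tdeg_add lookup_add distrib_left)
  have "enat n \<le> krull_dim T"
    unfolding M_def[symmetric]
  proof (rule krull_dim_ge_length_face_chain[OF M(1), where F = F])
    show "F i \<subseteq> M" for i
      by (auto simp: F_def)
    show "0 \<in> F i" for i
      using M(1) by (simp add: F_def L_def submonoid_set_def)
    show "a + b \<in> F i \<longleftrightarrow> a \<in> F i \<and> b \<in> F i" if "a \<in> M" "b \<in> M" for i a b
      using that M(1) L_add[OF that] by (auto simp: F_def submonoid_set_def)
    show "F (Suc i) \<subset> F i" if "i < n" for i
    proof -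
      obtain w where w: "w \<in> B" "\<forall>k<i. L k w = 0" "L i w \<noteq> 0"
        using exists_vertex_flag[OF assms \<open>i < n\<close>] unfolding B_def L_def q_def by blast
      then have "w \<in> F i - F (Suc i)"
        using BM by (auto simp: F_def)
      moreover have "F (Suc i) \<subseteq> F i"
        by (auto simp: F_def)
      ultimately show ?thesis
        by blast
    qed
  qed
  moreover have "krull_dim T \<le> enat n"
    unfolding M_def[symmetric] by (rule krull_dim_le_num_variables[OF M])
  ultimately show ?thesis
    using analytic_spread_eq unfolding veronese_ideal_eq B_def[symmetric] by simp
qed

lemma freiman_veronese_iff:
  assumes "0 < d" "d < 2 * n"
  shows "freiman n (veronese_ideal 2 n d :: ((nat \<Rightarrow>\<^sub>0 nat) \<Rightarrow>\<^sub>0 'k::field) set) \<longleftrightarrow>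
    int (card (box 4 n (2 * d))) = int n * int (card (box 2 n d)) - int (n choose 2)"
proof -
  have "equigenerated_monomial_ideal n (veronese_ideal 2 n d :: ((nat \<Rightarrow>\<^sub>0 nat) \<Rightarrow>\<^sub>0 'k) set)"
    unfolding equigenerated_monomial_ideal_def veronese_ideal_eq
    by (intro exI[of _ d] exI[of _ "veronese_exponents 2 n d"]) (auto simp: veronese_exponents_def)
  then show ?thesis
    by (simp add: freiman_def analytic_spread_veronese[OF assms] square_veronese_ideal min_num_gens_veronese)
qed

theorem theorem3p4:
  fixes n d :: nat
  assumes "0 < n" and "0 < d" and "2 \<le> d" and "d < 2 * n"
  shows "freiman n (veronese_ideal 2 n d :: ((nat \<Rightarrow>\<^sub>0 nat) \<Rightarrow>\<^sub>0 'k::field) set) \<longleftrightarrow>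
    (n = 2 \<and> (d = 2 \<or> d = 3)) \<or>
    (n = 3 \<and> (d = 2 \<or> d = 4 \<or> d = 5)) \<or>
    (4 \<le> n \<and> d = 2 * n - 1)"
proof -
  note iff = freiman_veronese_iff[OF assms(2,4), where 'k = 'k]
  consider "n = 2" | "n = 3" | "4 \<le> n" "d = 2 * n - 1" | "4 \<le> n" "d \<le> 2 * n - 2"
    using assms(3,4) by linarith
  then show ?thesis
  proof cases
    case 1
    then have "d = 2 \<or> d = 3"
      using assms(3,4) by auto
    with 1 show ?thesis
      unfolding iff card_box_eq_box_count by (auto simp: small_box_counts choose_two)
  next
    case 2
    then have "d = 2 \<or> d = 3 \<or> d = 4 \<or> d = 5"
      using assms(3,4) by auto
    with 2 show ?thesis
      unfolding iff card_box_eq_box_count by (auto simp: small_box_counts choose_two)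
  next
    case 3
    have "card (box 2 n d) = n"
    proof -
      have "2 * n - d = 1" "d \<le> 2 * n"
        using 3 by linarith+
      then show ?thesis
        using card_box_complement[of d 2 n] card_box_sum_1[of 2 n] by simp
    qed
    moreover have "card (box 4 n (2 * d)) = (n + 1) choose 2"
    proof -
      have "4 * n - 2 * d = 2" "2 * d \<le> 4 * n"
        using 3 by linarith+
      then show ?thesis
        using card_box_complement[of "2 * d" 4 n] card_box_sum_2[of 4 n] by simp
    qed
    moreover have "(n + 1) choose 2 = n + (n choose 2)"
      by (simp add: numeral_2_eq_2)
    ultimately have "freiman n (veronese_ideal 2 n d :: ((nat \<Rightarrow>\<^sub>0 nat) \<Rightarrow>\<^sub>0 'k) set)"
      unfolding iff using int_choose_two[of n] by (simp add: algebra_simps)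
    then show ?thesis
      using 3 by simp
  next
    case 4
    have "\<not> freiman n (veronese_ideal 2 n d :: ((nat \<Rightarrow>\<^sub>0 nat) \<Rightarrow>\<^sub>0 'k) set)"
      unfolding iff using card_box_4_gt[OF 4(1) assms(3) 4(2)] by simp
    then show ?thesis
      using 4 by simp
  qed
qed

end
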